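(* Let $D$ be a vertex-supported effective divisor on a metric graph $\Gamma$. Let $\mathcal{C}$ be the set of all cells of $|D|$ and $\mathcal{A}$ the set of all anchor cells of $|D|$. (1) There is a function $a:\mathcal{C}\to\mathcal{A}$ such that for each $C\in\mathcal{C}$ and a representative $L$ of $C$, the cell $a(C)$ is represented by an anchor divisor $N$ such that (i) $N(v)=L(v)$ for all vertices $v$ of $\Gamma$, and (ii) rational functions $f,g\in R(D)$ with $L=D+(f)$ and $N=D+(g)$ have the same outgoing slopes at the endpoints of every edge of $\Gamma$. (2) For this map $a$ and any anchor cell $A\in\mathcal{A}$, we have $|a^{-1}(A)|=2^{s(A)}$. Furthermore, for $0\le j\le s(A)$, there are exactly $\binom{s(A)}{j}$ cells of dimension $\dim A+j$ in $a^{-1}(A)$.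
   Context: A metric graph $\Gamma=(V,E)$ is a connected undirected graph whose edges have positive real lengths $M_e$. Divisors are finite formal $\mathbb{Z}$-combinations of points of $\Gamma$; effective means nonnegative coefficients; vertex-supported means support in $V$. A rational function is a continuous $f:\Gamma\to\mathbb{R}$, piecewise linear on each edge with finitely many pieces and integer slopes; $(f)=\sum_x\mathrm{ord}_x(f)x$ with $\mathrm{ord}_x(f)$ the sum of outgoing slopes of $f$ at $x$. $R(D)=\{f: D+(f)\text{ effective}\}$, $|D|=\{D+(f):f\in R(D)\}$. Cells of $|D|$: identify each open edge $e$ with $(0,M_e)$. A cell is given by data: nonnegative integers $d_v$ ($v\in V$); for some edges $e$ an ordered partition $d_e=\sum_{i=1}^{r_e}d_e^i$ into positive integers; integers $m_e$ ($e\in E$). $L\in|D|$ belongs to the cell iff $L(v)=d_v$ for all $v$; for edges with a partition $L|_{e^\circ}=\sum_{i}d_e^ix_i$ with $0<x_1<\dots<x_{r_e}<M_e$, and $L|_{e^\circ}=0$ for other edges; and every $f\in R(D)$ with $L=D+(f)$ has outgoing slope $m_e$ at $0\in e$ for all $e$. Elements of a cell are its representatives. For a representative $L$ of a cell $C$, with $I_L=\{x\in\Gamma\setminus V:L(x)>0\}$, $\dim C$ is one less than the number of connected components of $\Gamma\setminus I_L$. A divisor is an anchor divisor if each edge has at most one interior point where it is positive; a cell is an anchor cell if all its representatives are anchor divisors. For an anchor cell $A$: if $e_1,\dots,e_r$ are the edges on which the data of $A$ contain a (necessarily one-part) partition $c_i=c_i$, set $s(A)=\sum_{i=1}^r(c_i-1)$;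 if there are no such edges, $s(A)=0$. *)

theory Defs
  imports Complex_Main
begin

text \<open>A point of a metric graph: a vertex, or an interior point of an edge e,
  where the open edge e is identified with the open interval (0, M_e).
  Each edge carries an (arbitrary) orientation: position 0 is its source, M_e its target.\<close>

datatype ('v,'e) gpoint = Vert 'v | Inner 'e real

record ('v,'e) mgraph =
  verts :: "'v set"
  edges :: "'e set"
  esrc  :: "'e \<Rightarrow> 'v"
  etgt  :: "'e \<Rightarrow> 'v"
  elen  :: "'e \<Rightarrow> real"

definition metric_graph :: "('v,'e) mgraph \<Rightarrow> bool" where
  "metric_graph G \<longleftrightarrow> finite (verts G) \<and> finite (edges G) \<and> verts G \<noteq> {} \<and>
     (\<forall>e\<in>edges G. esrc G e \<in> verts G \<and> etgt G e \<in> verts G \<and> elen G e > 0) \<and>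
     (\<forall>u\<in>verts G. \<forall>v\<in>verts G.
        (\<lambda>a b. \<exists>e\<in>edges G. (a = esrc G e \<and> b = etgt G e) \<or> (a = etgt G e \<and> b = esrc G e))\<^sup>*\<^sup>* u v)"

definition gpoints :: "('v,'e) mgraph \<Rightarrow> ('v,'e) gpoint set" where
  "gpoints G = Vert ` verts G \<union> {Inner e t | e t. e \<in> edges G \<and> 0 < t \<and> t < elen G e}"

definition pt_of :: "('v,'e) mgraph \<Rightarrow> 'e \<Rightarrow> real \<Rightarrow> ('v,'e) gpoint" where
  "pt_of G e t = (if t = 0 then Vert (esrc G e) else if t = elen G e then Vert (etgt G e) else Inner e t)"

definition edge_fun :: "('v,'e) mgraph \<Rightarrow> (('v,'e) gpoint \<Rightarrow> real) \<Rightarrow> 'e \<Rightarrow> real \<Rightarrow> real" where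
  "edge_fun G f e = (\<lambda>t. f (pt_of G e t))"

definition pl_int :: "real \<Rightarrow> (real \<Rightarrow> real) \<Rightarrow> bool" where
  "pl_int M \<phi> \<longleftrightarrow> (\<exists>ts::real list. length ts \<ge> 2 \<and> sorted_wrt (<) ts \<and> hd ts = 0 \<and> last ts = M \<and>
     (\<forall>i. Suc i < length ts \<longrightarrow> (\<exists>s::int. \<forall>t. ts!i \<le> t \<and> t \<le> ts!Suc i \<longrightarrow>
          \<phi> t = \<phi> (ts!i) + of_int s * (t - ts!i))))"

definition rational_function :: "('v,'e) mgraph \<Rightarrow> (('v,'e) gpoint \<Rightarrow> real) \<Rightarrow> bool" where
  "rational_function G f \<longleftrightarrow> (\<forall>e\<in>edges G. pl_int (elen G e) (edge_fun G f e))"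

definition dslope :: "(real \<Rightarrow> real) \<Rightarrow> real \<Rightarrow> real \<Rightarrow> int" where
  "dslope \<phi> t d = (THE s::int. \<exists>\<delta>>0. \<forall>h. 0 < h \<and> h < \<delta> \<longrightarrow> \<phi> (t + d * h) = \<phi> t + of_int s * h)"

definition ord :: "('v,'e) mgraph \<Rightarrow> (('v,'e) gpoint \<Rightarrow> real) \<Rightarrow> ('v,'e) gpoint \<Rightarrow> int" where
  "ord G f x = (case x of
      Vert v \<Rightarrow> (\<Sum>e\<in>{e\<in>edges G. esrc G e = v}. dslope (edge_fun G f e) 0 1)
              + (\<Sum>e\<in>{e\<in>edges G. etgt G e = v}. dslope (edge_fun G f e) (elen G e) (-1))
    | Inner e t \<Rightarrow> dslope (edge_fun G f e) t 1 + dslope (edge_fun G f e) t (-1))"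

definition prin_div :: "('v,'e) mgraph \<Rightarrow> (('v,'e) gpoint \<Rightarrow> real) \<Rightarrow> ('v,'e) gpoint \<Rightarrow> int" where
  "prin_div G f x = (if x \<in> gpoints G then ord G f x else 0)"

definition effective :: "(('v,'e) gpoint \<Rightarrow> int) \<Rightarrow> bool" where
  "effective L \<longleftrightarrow> (\<forall>x. 0 \<le> L x)"

definition vertex_supported :: "('v,'e) mgraph \<Rightarrow> (('v,'e) gpoint \<Rightarrow> int) \<Rightarrow> bool" where
  "vertex_supported G L \<longleftrightarrow> (\<forall>x. L x \<noteq> 0 \<longrightarrow> x \<in> Vert ` verts G)"

definition RD :: "('v,'e) mgraph \<Rightarrow> (('v,'e) gpoint \<Rightarrow> int) \<Rightarrow> (('v,'e) gpoint \<Rightarrow> real) set" where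
  "RD G D = {f. rational_function G f \<and> effective (\<lambda>x. D x + prin_div G f x)}"

definition linsys :: "('v,'e) mgraph \<Rightarrow> (('v,'e) gpoint \<Rightarrow> int) \<Rightarrow> (('v,'e) gpoint \<Rightarrow> int) set" where
  "linsys G D = {(\<lambda>x. D x + prin_div G f x) | f. f \<in> RD G D}"

text \<open>Cell data: (d_v)_v, for each edge an ordered partition given as a list of positive
  integers (the empty list meaning that the edge carries no partition), and (m_e)_e.\<close>
type_synonym ('v,'e) cell_data = "('v \<Rightarrow> nat) \<times> ('e \<Rightarrow> nat list) \<times> ('e \<Rightarrow> int)"

definition in_cell :: "('v,'e) mgraph \<Rightarrow> (('v,'e) gpoint \<Rightarrow> int) \<Rightarrow> ('v,'e) cell_data
      \<Rightarrow> (('v,'e) gpoint \<Rightarrow> int) \<Rightarrow> bool" where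
  "in_cell G D c L \<longleftrightarrow> (case c of (d, p, m) \<Rightarrow>
     L \<in> linsys G D \<and>
     (\<forall>v\<in>verts G. L (Vert v) = int (d v)) \<and>
     (\<forall>e\<in>edges G. (\<forall>k\<in>set (p e). 0 < k) \<and>
        (\<exists>xs::real list. length xs = length (p e) \<and> sorted_wrt (<) xs \<and>
           (\<forall>x\<in>set xs. 0 < x \<and> x < elen G e) \<and>
           (\<forall>t. 0 < t \<and> t < elen G e \<longrightarrow>
              L (Inner e t) = (\<Sum>i<length xs. if xs!i = t then int (p e ! i) else 0)))) \<and>
     (\<forall>f\<in>RD G D. L = (\<lambda>x. D x + prin_div G f x) \<longrightarrow>
        (\<forall>e\<in>edges G. dslope (edge_fun G f e) 0 1 = m e)))"

definition cell_of :: "('v,'e) mgraph \<Rightarrow> (('v,'e) gpoint \<Rightarrow> int) \<Rightarrow> ('v,'e) cell_data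
      \<Rightarrow> (('v,'e) gpoint \<Rightarrow> int) set" where
  "cell_of G D c = {L. in_cell G D c L}"

text \<open>The set of all cells of |D| (a cell is identified with its set of representatives;
  only nonempty cells count).\<close>
definition cells :: "('v,'e) mgraph \<Rightarrow> (('v,'e) gpoint \<Rightarrow> int) \<Rightarrow> (('v,'e) gpoint \<Rightarrow> int) set set" where
  "cells G D = {C. \<exists>c. C = cell_of G D c \<and> C \<noteq> {}}"

definition anchor_div :: "('v,'e) mgraph \<Rightarrow> (('v,'e) gpoint \<Rightarrow> int) \<Rightarrow> bool" where
  "anchor_div G L \<longleftrightarrow> (\<forall>e\<in>edges G. \<forall>s t. 0 < s \<and> s < elen G e \<and> 0 < t \<and> t < elen G e \<and>
      L (Inner e s) > 0 \<and> L (Inner e t) > 0 \<longrightarrow> s = t)"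

definition anchor_cells :: "('v,'e) mgraph \<Rightarrow> (('v,'e) gpoint \<Rightarrow> int) \<Rightarrow> (('v,'e) gpoint \<Rightarrow> int) set set" where
  "anchor_cells G D = {A \<in> cells G D. \<forall>L\<in>A. anchor_div G L}"

definition s_anchor :: "('v,'e) mgraph \<Rightarrow> (('v,'e) gpoint \<Rightarrow> int) \<Rightarrow> (('v,'e) gpoint \<Rightarrow> int) set \<Rightarrow> nat" where
  "s_anchor G D A = (SOME n. \<exists>d p m. A = cell_of G D (d, p, m) \<and>
      n = (\<Sum>e\<in>edges G. (case p e of [c] \<Rightarrow> c - 1 | _ \<Rightarrow> 0)))"

definition interior_supp :: "('v,'e) mgraph \<Rightarrow> (('v,'e) gpoint \<Rightarrow> int) \<Rightarrow> ('v,'e) gpoint set" where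
  "interior_supp G L = {x \<in> gpoints G - Vert ` verts G. L x > 0}"

definition gstep :: "('v,'e) mgraph \<Rightarrow> ('v,'e) gpoint set \<Rightarrow> ('v,'e) gpoint \<Rightarrow> ('v,'e) gpoint \<Rightarrow> bool" where
  "gstep G I x y \<longleftrightarrow> (\<exists>e\<in>edges G. \<exists>s t. 0 \<le> s \<and> s \<le> elen G e \<and> 0 \<le> t \<and> t \<le> elen G e \<and>
      x = pt_of G e s \<and> y = pt_of G e t \<and>
      (\<forall>u. min s t \<le> u \<and> u \<le> max s t \<longrightarrow> pt_of G e u \<notin> I))"

definition components :: "('v,'e) mgraph \<Rightarrow> ('v,'e) gpoint set \<Rightarrow> ('v,'e) gpoint set set" where
  "components G I = (\<lambda>x. {y \<in> gpoints G - I. x = y \<or> (gstep G I)\<^sup>*\<^sup>* x y}) ` (gpoints G - I)"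

definition cell_dim :: "('v,'e) mgraph \<Rightarrow> (('v,'e) gpoint \<Rightarrow> int) set \<Rightarrow> nat" where
  "cell_dim G C = card (components G (interior_supp G (SOME L. L \<in> C))) - 1"

end

(*
  On every edge a member of |D| is a row of chips. Moving chips within an edge while keeping their
  number and their centre of mass changes the divisor by (h) for a function h that vanishes near
  all vertices. Hence a cell with data (d, p, m) is nonempty iff the cell with data (d, q, m) is,
  for any q with the same edge sums as p, and a(C) merges each partition into a single part. The
  fibre over an anchor cell is then a family of independent compositions of the numbers c_i, one
  for each occupied edge. A composition of c_i with r parts adds r - 1 to the dimension, so the
  counts are convolutions of the binomial coefficients of c_i - 1.
*)
theory Submission
  imports Defs
begin

section \<open>One-sided slopes and piecewise linear functions\<close>

text \<open>The function behind a move is a difference of two ramps, the second antiderivatives of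
  the chips. Past the last chip a ramp is a line fixed by the number of chips and their first
  moment, which is why these two quantities are kept. An arbitrary \<open>q\<close> can be realised
  because the centre of mass lies strictly inside the edge, and any list of parts can be packed
  closely around it.

  The data record the slope of \<open>f\<close> only at the source of an edge. The slope at the
  target follows: subtracting the ramp of the chips from \<open>f\<close> leaves no kinks inside the
  edge, so the target slope depends on \<open>m e\<close> and the number of chips, and merging keeps
  both.

  Breakpoint lists behave badly under sums, so piecewise linearity is recast as the existence of
  integer one-sided slopes at every point.

  Cells are sets of divisors, so counting them requires that one representative determines the data.
  In the dimension, the components containing a vertex depend only on which edges carry chips; the
  others are inner pieces of edges, and \<open>r\<close> cuts on an edge produce
  \<open>r - 1\<close> of them.\<close>

definition has_dslope :: "(real \<Rightarrow> real) \<Rightarrow> real \<Rightarrow> real \<Rightarrow> int \<Rightarrow> bool" where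
  "has_dslope \<phi> t d s \<longleftrightarrow> (\<exists>\<delta>>0. \<forall>h. 0 < h \<and> h < \<delta> \<longrightarrow> \<phi> (t + d * h) = \<phi> t + of_int s * h)"

lemma has_dslope_unique:
  assumes "has_dslope \<phi> t d s" "has_dslope \<phi> t d s'"
  shows "s = s'"
proof -
  from assms(1) obtain a where a: "a > 0" "\<And>h. 0 < h \<Longrightarrow> h < a \<Longrightarrow> \<phi> (t + d * h) = \<phi> t + of_int s * h"
    unfolding has_dslope_def by blast
  from assms(2) obtain b where b: "b > 0" "\<And>h. 0 < h \<Longrightarrow> h < b \<Longrightarrow> \<phi> (t + d * h) = \<phi> t + of_int s' * h"
    unfolding has_dslope_def by blast
  obtain h where h: "0 < h" "h < min a b"
    using a(1) b(1) field_lbound_gt_zero min_less_iff_conj by metis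
  have "of_int s * h = (of_int s' * h :: real)" using a(2)[of h] b(2)[of h] h by simp
  with h(1) show ?thesis by simp
qed

text \<open>\<open>dslope\<close> is a definite description and says nothing unless a slope exists.
  The relation \<open>has_dslope\<close> carries the existence, so slopes are computed with it and
  transferred here.\<close>

lemma dslope_eq:
  assumes "has_dslope \<phi> t d s"
  shows "dslope \<phi> t d = s"
  unfolding dslope_def has_dslope_def[symmetric]
  using assms has_dslope_unique by blast

lemma has_dslope_add:
  assumes "has_dslope \<phi> t d s" "has_dslope \<psi> t d s'"
  shows "has_dslope (\<lambda>x. \<phi> x + \<psi> x) t d (s + s')"
proof -
  from assms(1) obtain a where a: "a > 0" "\<And>h. 0 < h \<Longrightarrow> h < a \<Longrightarrow> \<phi> (t + d * h) = \<phi> t + of_int s * h"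
    unfolding has_dslope_def by blast
  from assms(2) obtain b where b: "b > 0" "\<And>h. 0 < h \<Longrightarrow> h < b \<Longrightarrow> \<psi> (t + d * h) = \<psi> t + of_int s' * h"
    unfolding has_dslope_def by blast
  show ?thesis unfolding has_dslope_def
    by (rule exI[of _ "min a b"]) (use a b in \<open>auto simp: algebra_simps\<close>)
qed

lemma has_dslope_cmult:
  assumes "has_dslope \<phi> t d s"
  shows "has_dslope (\<lambda>x. of_int c * \<phi> x) t d (c * s)"
proof -
  from assms obtain a where a: "a > 0" "\<And>h. 0 < h \<Longrightarrow> h < a \<Longrightarrow> \<phi> (t + d * h) = \<phi> t + of_int s * h"
    unfolding has_dslope_def by blast
  show ?thesis unfolding has_dslope_def
    by (rule exI[of _ a]) (use a in \<open>auto simp: algebra_simps\<close>)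
qed

lemma has_dslope_diff:
  assumes "has_dslope \<phi> t d s" "has_dslope \<psi> t d s'"
  shows "has_dslope (\<lambda>x. \<phi> x - \<psi> x) t d (s - s')"
  using has_dslope_add[OF assms(1) has_dslope_cmult[OF assms(2), of "-1"]] by simp

lemma has_dslope_sum:
  assumes "\<And>i. i \<in> A \<Longrightarrow> has_dslope (\<phi> i) t d (s i)"
  shows "has_dslope (\<lambda>x. \<Sum>i\<in>A. \<phi> i x) t d (\<Sum>i\<in>A. s i)"
  using assms
proof (induction A rule: infinite_finite_induct)
  case (insert a A)
  then show ?case using has_dslope_add by simp
qed (auto simp: has_dslope_def intro: exI[of _ 1])

lemma has_dslope_hinge_right:
  "has_dslope (\<lambda>t. max 0 (t - x)) t 1 (if x \<le> t then 1 else 0)"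
  unfolding has_dslope_def
  by (rule exI[of _ "if x \<le> t then 1 else x - t"]) auto

lemma has_dslope_hinge_left:
  "has_dslope (\<lambda>t. max 0 (t - x)) t (- 1) (if x < t then - 1 else 0)"
  unfolding has_dslope_def
  by (rule exI[of _ "if x < t then t - x else 1"]) auto

lemma ex_nat_switch:
  assumes "P (0::nat)" "\<not> P n"
  shows "\<exists>i<n. P i \<and> \<not> P (Suc i)"
  using assms by (induction n) (auto simp: less_Suc_eq)

lemma has_dslope_right_affine:
  assumes "\<And>u. a \<le> u \<Longrightarrow> u \<le> b \<Longrightarrow> \<phi> u = \<phi> a + of_int s * (u - a)" "a \<le> t" "t < b"
  shows "has_dslope \<phi> t 1 s"
  unfolding has_dslope_def
proof (intro exI[of _ "b - t"] conjI allI impI)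
  fix h assume "0 < h \<and> h < b - t"
  then show "\<phi> (t + 1 * h) = \<phi> t + of_int s * h"
    using assms(1)[of "t + 1 * h"] assms(1)[of t] assms(2,3) by (simp add: algebra_simps)
qed (use assms in auto)

lemma has_dslope_left_affine:
  assumes "\<And>u. a \<le> u \<Longrightarrow> u \<le> b \<Longrightarrow> \<phi> u = \<phi> a + of_int s * (u - a)" "a < t" "t \<le> b"
  shows "has_dslope \<phi> t (- 1) (- s)"
  unfolding has_dslope_def
proof (intro exI[of _ "t - a"] conjI allI impI)
  fix h assume "0 < h \<and> h < t - a"
  then show "\<phi> (t + - 1 * h) = \<phi> t + of_int (- s) * h"
    using assms(1)[of "t + - 1 * h"] assms(1)[of t] assms(2,3) by (simp add: algebra_simps)
qed (use assms in auto)

text \<open>The condition of \<open>pl_int\<close> with a movable left end, so that pieces can be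
  glued along [0, M].\<close>

definition pl_between :: "real \<Rightarrow> real \<Rightarrow> (real \<Rightarrow> real) \<Rightarrow> bool" where
  "pl_between a b \<phi> \<longleftrightarrow> (\<exists>ts::real list. length ts \<ge> 2 \<and> sorted_wrt (<) ts \<and> hd ts = a \<and> last ts = b \<and>
     (\<forall>i. Suc i < length ts \<longrightarrow> (\<exists>s::int. \<forall>t. ts!i \<le> t \<and> t \<le> ts!Suc i \<longrightarrow>
          \<phi> t = \<phi> (ts!i) + of_int s * (t - ts!i))))"

lemma pl_int_iff_between: "pl_int M \<phi> \<longleftrightarrow> pl_between 0 M \<phi>"
  unfolding pl_int_def pl_between_def ..

lemma pl_between_affine:
  assumes "a < b" "\<And>t. a \<le> t \<Longrightarrow> t \<le> b \<Longrightarrow> \<phi> t = \<phi> a + of_int s * (t - a)"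
  shows "pl_between a b \<phi>"
  unfolding pl_between_def
proof (intro exI[of _ "[a, b]"] conjI allI impI)
  fix i assume "Suc i < length [a, b]"
  then have "i = 0" by simp
  then show "\<exists>s::int. \<forall>t. [a, b]!i \<le> t \<and> t \<le> [a, b]!Suc i \<longrightarrow> \<phi> t = \<phi> ([a, b]!i) + of_int s * (t - [a, b]!i)"
    using assms(2) by (intro exI[of _ s]) (simp only: nth_Cons_0 nth_Cons_Suc, blast)
qed (use assms(1) in simp_all)

lemma pl_between_trans:
  assumes "pl_between a b \<phi>" "pl_between b c \<phi>"
  shows "pl_between a c \<phi>"
proof -
  let ?aff = "\<lambda>u v. \<exists>s::int. \<forall>t. u \<le> t \<and> t \<le> v \<longrightarrow> \<phi> t = \<phi> u + of_int s * (t - u)"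
  from assms(1) obtain us where us: "length us \<ge> 2" "sorted_wrt (<) us" "hd us = a" "last us = b"
    "\<forall>i. Suc i < length us \<longrightarrow> ?aff (us!i) (us!Suc i)"
    unfolding pl_between_def by (elim exE conjE) (rule that)
  from assms(2) obtain vs where vs: "length vs \<ge> 2" "sorted_wrt (<) vs" "hd vs = b" "last vs = c"
    "\<forall>i. Suc i < length vs \<longrightarrow> ?aff (vs!i) (vs!Suc i)"
    unfolding pl_between_def by (elim exE conjE) (rule that)
  obtain vs' where vs': "vs = b # vs'" "vs' \<noteq> []" using vs(1,3) by (cases vs) (auto simp: Suc_le_eq)
  obtain us' where us': "us = us' @ [b]" using us(1,4) by (cases us rule: rev_cases) auto
  have ne: "us' \<noteq> []" using us(1) us' by auto
  have "length (us @ vs') \<ge> 2" using us(1) by simp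
  moreover have "sorted_wrt (<) (us @ vs')"
  proof -
    have "sorted_wrt (<) us'" "\<And>x. x \<in> set us' \<Longrightarrow> x < b"
      using us(2) unfolding us' by (simp_all add: sorted_wrt_append)
    moreover have "sorted_wrt (<) vs'" "\<And>y. y \<in> set vs' \<Longrightarrow> b < y"
      using vs(2) unfolding vs'(1) by simp_all
    ultimately show ?thesis
      unfolding us' sorted_wrt_append by (auto intro: less_trans[of _ b])
  qed
  moreover have "hd (us @ vs') = a" "last (us @ vs') = c"
    using us(3) vs(4) us(1) vs' by (auto simp: hd_append)
  moreover have "?aff ((us @ vs')!i) ((us @ vs')!Suc i)" if i: "Suc i < length (us @ vs')" for i
  proof (cases "Suc i < length us")
    case True
    then show ?thesis using us(5)[rule_format, OF True] by (simp add: nth_append)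
  next
    case False
    \<comment> \<open>The shared breakpoint \<open>b\<close> ends \<open>us\<close> and starts
      \<open>vs\<close>, so the joined list is both \<open>us @ vs'\<close> and
      \<open>us' @ vs\<close>; the second reading gives the later pieces the indices of
      \<open>vs\<close>.\<close>
    define j where "j = i - length us'"
    have ij: "i = length us' + j" using False us' j_def by simp
    have eq: "us @ vs' = us' @ vs" using us' vs' by simp
    have "Suc j < length vs" using i ij eq by simp
    from vs(5)[rule_format, OF this] show ?thesis unfolding eq ij by (simp add: nth_append)
  qed
  ultimately show ?thesis
    unfolding pl_between_def by (intro exI[of _ "us @ vs'"] conjI allI impI)
qed

text \<open>Compactness for one-sided local information: a short interval around \<open>x\<close> is
  cut at \<open>x\<close>, each half is covered by the hypothesis for its side, and transitivity
  glues the halves.\<close>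

lemma Bolzano_one_sided:
  fixes P :: "real \<Rightarrow> real \<Rightarrow> bool"
  assumes M: "l < u"
    and trans: "\<And>a b c. l \<le> a \<Longrightarrow> a < b \<Longrightarrow> b < c \<Longrightarrow> c \<le> u \<Longrightarrow> P a b \<Longrightarrow> P b c \<Longrightarrow> P a c"
    and right: "\<And>x. l \<le> x \<Longrightarrow> x < u \<Longrightarrow> \<exists>\<delta>>0. \<forall>b. x < b \<and> b < x + \<delta> \<and> b \<le> u \<longrightarrow> P x b"
    and left: "\<And>x. l < x \<Longrightarrow> x \<le> u \<Longrightarrow> \<exists>\<delta>>0. \<forall>a. l \<le> a \<and> x - \<delta> < a \<and> a < x \<longrightarrow> P a x"
  shows "P l u"
proof -
  \<comment> \<open>\<open>Bolzano\<close> also quantifies over degenerate intervals and over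
    intervals leaving [l, u], about which the hypotheses are silent; \<open>Q\<close> holds
    vacuously on these.\<close>
  define Q where "Q a b \<longleftrightarrow> (l \<le> a \<and> a < b \<and> b \<le> u \<longrightarrow> P a b)" for a b
  have "l \<le> u" using M by simp
  then have "Q l u"
  proof (induction rule: Bolzano)
    case (trans a b c)
    then show ?case unfolding Q_def using assms(2)[of a b c]
      by (cases "a = b"; cases "b = c") auto
  next
    case (local x)
    have "\<exists>\<delta>>0. \<forall>b. x < b \<and> b < x + \<delta> \<and> b \<le> u \<longrightarrow> P x b"
      using right[of x] local by (cases "x < u") (auto intro: exI[of _ 1])
    then obtain d1 where d1: "d1 > 0" "\<And>b. x < b \<Longrightarrow> b < x + d1 \<Longrightarrow> b \<le> u \<Longrightarrow> P x b"
      by blast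
    have "\<exists>\<delta>>0. \<forall>a. l \<le> a \<and> x - \<delta> < a \<and> a < x \<longrightarrow> P a x"
      using left[of x] local by (cases "l < x") (auto intro: exI[of _ 1])
    then obtain d2 where d2: "d2 > 0" "\<And>a. l \<le> a \<Longrightarrow> x - d2 < a \<Longrightarrow> a < x \<Longrightarrow> P a x"
      by blast
    show ?case
    proof (intro exI[of _ "min d1 d2"] conjI allI impI)
      fix a b assume ab: "a \<le> x \<and> x \<le> b \<and> b - a < min d1 d2"
      show "Q a b" unfolding Q_def
      proof
        assume r: "l \<le> a \<and> a < b \<and> b \<le> u"
        have "P x b" if "x < b" using d1(2)[of b] ab r that by auto
        moreover have "P a x" if "a < x" using d2(2)[of a] ab r that by auto
        ultimately show "P a b" using trans[of a x b] ab r
          by (cases "a = x"; cases "b = x") auto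
      qed
    qed (use d1 d2 in auto)
  qed
  then show ?thesis using M unfolding Q_def by simp
qed

text \<open>This turns piecewise linearity into a pointwise condition, so sums and differences need
  no common refinement of breakpoint lists. From left to right, \<open>t\<close> lies in some linear
  piece on the relevant side. From right to left, a slope at \<open>x\<close> makes the function
  linear on short intervals beside \<open>x\<close>, and compactness assembles a finite list of
  breakpoints.\<close>

lemma pl_int_iff_dslopes:
  "pl_int M \<phi> \<longleftrightarrow> 0 < M \<and> (\<forall>t. 0 \<le> t \<and> t < M \<longrightarrow> (\<exists>s. has_dslope \<phi> t 1 s)) \<and>
     (\<forall>t. 0 < t \<and> t \<le> M \<longrightarrow> (\<exists>s. has_dslope \<phi> t (- 1) s))" (is "_ \<longleftrightarrow> ?R")
proof
  assume "pl_int M \<phi>"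
  then obtain ts where len: "length ts \<ge> 2" and sorted: "sorted_wrt (<) ts"
    and hd: "hd ts = 0" and last: "last ts = M"
    and aff: "\<forall>i. Suc i < length ts \<longrightarrow> (\<exists>s::int. \<forall>t. ts!i \<le> t \<and> t \<le> ts!Suc i \<longrightarrow>
          \<phi> t = \<phi> (ts!i) + of_int s * (t - ts!i))"
    unfolding pl_int_def by (elim exE conjE) (rule that)
  let ?n = "length ts - 1"
  have ts0: "ts ! 0 = 0" and tsn: "ts ! ?n = M"
    using hd last len hd_conv_nth[of ts] last_conv_nth[of ts] by fastforce+
  have "0 < M" using sorted_wrt_nth_less[OF sorted, of 0 ?n] ts0 tsn len by simp
  moreover have "\<exists>s. has_dslope \<phi> t 1 s" if t: "0 \<le> t" "t < M" for t
  proof -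
    obtain i where i: "i < ?n" "ts!i \<le> t" "\<not> ts!Suc i \<le> t"
      using ex_nat_switch[of "\<lambda>i. ts!i \<le> t" ?n] ts0 tsn t by auto
    obtain s where "\<And>u. ts!i \<le> u \<Longrightarrow> u \<le> ts!Suc i \<Longrightarrow> \<phi> u = \<phi> (ts!i) + of_int s * (u - ts!i)"
      using aff[rule_format, of i] i(1) by (metis less_diff_conv Suc_eq_plus1)
    from has_dslope_right_affine[of "ts!i" "ts!Suc i" \<phi> s t, OF this] i show ?thesis by auto
  qed
  moreover have "\<exists>s. has_dslope \<phi> t (- 1) s" if t: "0 < t" "t \<le> M" for t
  proof -
    obtain i where i: "i < ?n" "ts!i < t" "\<not> ts!Suc i < t"
      using ex_nat_switch[of "\<lambda>i. ts!i < t" ?n] ts0 tsn t by auto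
    obtain s where "\<And>u. ts!i \<le> u \<Longrightarrow> u \<le> ts!Suc i \<Longrightarrow> \<phi> u = \<phi> (ts!i) + of_int s * (u - ts!i)"
      using aff[rule_format, of i] i(1) by (metis less_diff_conv Suc_eq_plus1)
    from has_dslope_left_affine[of "ts!i" "ts!Suc i" \<phi> s t, OF this] i show ?thesis by auto
  qed
  ultimately show ?R by blast
next
  assume R: ?R
  then have M: "0 < M" by blast
  have "pl_between 0 M \<phi>"
  proof (rule Bolzano_one_sided[of 0 M "\<lambda>a b. pl_between a b \<phi>"])
    fix x assume x: "0 \<le> x" "x < M"
    then obtain s where "has_dslope \<phi> x 1 s" using R by blast
    then obtain \<delta> where s: "\<delta> > 0" "\<And>h. 0 < h \<Longrightarrow> h < \<delta> \<Longrightarrow> \<phi> (x + 1 * h) = \<phi> x + of_int s * h"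
      unfolding has_dslope_def by blast
    have "pl_between x b \<phi>" if b: "x < b" "b < x + \<delta>" for b
    proof (rule pl_between_affine[of _ _ _ s])
      fix t assume "x \<le> t" "t \<le> b"
      then show "\<phi> t = \<phi> x + of_int s * (t - x)"
        using s(2)[of "t - x"] b by (cases "t = x") auto
    qed (use b in auto)
    then show "\<exists>\<delta>>0. \<forall>b. x < b \<and> b < x + \<delta> \<and> b \<le> M \<longrightarrow> pl_between x b \<phi>" using s(1) by blast
  next
    fix x assume x: "0 < x" "x \<le> M"
    then obtain s where "has_dslope \<phi> x (- 1) s" using R by blast
    then obtain \<delta> where s: "\<delta> > 0" "\<And>h. 0 < h \<Longrightarrow> h < \<delta> \<Longrightarrow> \<phi> (x + - 1 * h) = \<phi> x + of_int s * h"
      unfolding has_dslope_def by blast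
    have eq: "\<phi> t = \<phi> x + of_int s * (x - t)" if "x - \<delta> < t" "t \<le> x" for t
      using s(2)[of "x - t"] that by (cases "t = x") auto
    have "pl_between a x \<phi>" if a: "x - \<delta> < a" "a < x" for a
    proof (rule pl_between_affine[of _ _ _ "- s"])
      fix t assume "a \<le> t" "t \<le> x"
      then show "\<phi> t = \<phi> a + of_int (- s) * (t - a)"
        using eq[of t] eq[of a] a by (simp add: algebra_simps)
    qed (use a in auto)
    then show "\<exists>\<delta>>0. \<forall>a. 0 \<le> a \<and> x - \<delta> < a \<and> a < x \<longrightarrow> pl_between a x \<phi>" using s(1) by blast
  qed (use M in \<open>auto intro: pl_between_trans\<close>)
  then show "pl_int M \<phi>" unfolding pl_int_iff_between .
qed

lemma pl_int_has_dslope: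
  assumes "pl_int M \<phi>"
  shows "0 \<le> t \<Longrightarrow> t < M \<Longrightarrow> has_dslope \<phi> t 1 (dslope \<phi> t 1)"
    and "0 < t \<Longrightarrow> t \<le> M \<Longrightarrow> has_dslope \<phi> t (- 1) (dslope \<phi> t (- 1))"
proof -
  have *: "has_dslope \<phi> t d (dslope \<phi> t d)" if "\<exists>s. has_dslope \<phi> t d s" for d
    using that by (auto simp: dslope_eq)
  show "0 \<le> t \<Longrightarrow> t < M \<Longrightarrow> has_dslope \<phi> t 1 (dslope \<phi> t 1)"
    and "0 < t \<Longrightarrow> t \<le> M \<Longrightarrow> has_dslope \<phi> t (- 1) (dslope \<phi> t (- 1))"
    using assms unfolding pl_int_iff_dslopes by (auto intro!: *)
qed

text \<open>Without kinks the function is a single line. Rather than constructing the line, the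
  proof propagates the relation "the outgoing slopes at the two ends of the interval cancel": it
  holds on short intervals beside each point, and the absence of a kink at \<open>b\<close> lets it
  pass across \<open>b\<close>.\<close>

lemma end_slopes_cancel:
  assumes pl: "pl_int M \<phi>"
    and kinks: "\<And>t. 0 < t \<Longrightarrow> t < M \<Longrightarrow> dslope \<phi> t 1 + dslope \<phi> t (- 1) = 0"
  shows "dslope \<phi> M (- 1) = - dslope \<phi> 0 1"
proof -
  have M: "0 < M"
    using pl unfolding pl_int_iff_dslopes by blast
  show ?thesis
  proof (rule Bolzano_one_sided[of 0 M "\<lambda>a b. dslope \<phi> b (- 1) = - dslope \<phi> a 1"])
    fix a b c assume "0 \<le> a" "a < b" "b < c" "c \<le> M"
      "dslope \<phi> b (- 1) = - dslope \<phi> a 1" "dslope \<phi> c (- 1) = - dslope \<phi> b 1"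
    then show "dslope \<phi> c (- 1) = - dslope \<phi> a 1"
      using kinks[of b] by linarith
  next
    fix x assume x: "0 \<le> x" "x < M"
    obtain \<delta> where s: "\<delta> > 0" "\<And>h. 0 < h \<Longrightarrow> h < \<delta> \<Longrightarrow> \<phi> (x + 1 * h) = \<phi> x + of_int (dslope \<phi> x 1) * h"
      using pl_int_has_dslope(1)[OF pl x] unfolding has_dslope_def by metis
    have "dslope \<phi> b (- 1) = - dslope \<phi> x 1" if b: "x < b" "b < x + \<delta>" for b
    proof -
      have "\<phi> u = \<phi> x + of_int (dslope \<phi> x 1) * (u - x)" if "x \<le> u" "u \<le> b" for u
        using s(2)[of "u - x"] b that by (cases "u = x") auto
      from has_dslope_left_affine[OF this b(1) order_refl] show ?thesis
        by (rule dslope_eq)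
    qed
    then show "\<exists>\<delta>>0. \<forall>b. x < b \<and> b < x + \<delta> \<and> b \<le> M \<longrightarrow> dslope \<phi> b (- 1) = - dslope \<phi> x 1"
      using s(1) by blast
  next
    fix x assume x: "0 < x" "x \<le> M"
    obtain \<delta> where s: "\<delta> > 0" "\<And>h. 0 < h \<Longrightarrow> h < \<delta> \<Longrightarrow> \<phi> (x + - 1 * h) = \<phi> x + of_int (dslope \<phi> x (- 1)) * h"
      using pl_int_has_dslope(2)[OF pl x] unfolding has_dslope_def by metis
    have eq: "\<phi> t = \<phi> x + of_int (dslope \<phi> x (- 1)) * (x - t)" if "x - \<delta> < t" "t \<le> x" for t
      using s(2)[of "x - t"] that by (cases "t = x") auto
    have "dslope \<phi> x (- 1) = - dslope \<phi> a 1" if a: "x - \<delta> < a" "a < x" for a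
    proof -
      have "\<phi> u = \<phi> a + of_int (- dslope \<phi> x (- 1)) * (u - a)" if "a \<le> u" "u \<le> x" for u
        using eq[of u] eq[of a] a that by (simp add: algebra_simps)
      from has_dslope_right_affine[OF this order_refl a(2)]
      have "dslope \<phi> a 1 = - dslope \<phi> x (- 1)" by (rule dslope_eq)
      then show ?thesis by linarith
    qed
    then show "\<exists>\<delta>>0. \<forall>a. 0 \<le> a \<and> x - \<delta> < a \<and> a < x \<longrightarrow> dslope \<phi> x (- 1) = - dslope \<phi> a 1"
      using s(1) by blast
  qed (rule M)
qed

section \<open>Chips on an edge\<close>

definition placed :: "real \<Rightarrow> nat list \<Rightarrow> real list \<Rightarrow> bool" where
  "placed M p xs \<longleftrightarrow> (\<forall>k\<in>set p. 0 < k) \<and> length xs = length p \<and> sorted_wrt (<) xs \<and>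
     (\<forall>x\<in>set xs. 0 < x \<and> x < M)"

definition mass_at :: "nat list \<Rightarrow> real list \<Rightarrow> real \<Rightarrow> int" where
  "mass_at p xs t = (\<Sum>i<length xs. if xs!i = t then int (p!i) else 0)"

definition moment :: "nat list \<Rightarrow> real list \<Rightarrow> real" where
  "moment p xs = (\<Sum>i<length xs. real (p!i) * xs!i)"

text \<open>The second antiderivative of the chips: it is zero to the left of every chip and bends
  by \<open>p!i\<close> at \<open>xs!i\<close>.\<close>

definition ramp :: "nat list \<Rightarrow> real list \<Rightarrow> real \<Rightarrow> real" where
  "ramp p xs t = (\<Sum>i<length xs. real (p!i) * max 0 (t - xs!i))"

lemma ramp_right_slope:
  "has_dslope (ramp p xs) t 1 (\<Sum>i<length xs. int (p!i) * (if xs!i \<le> t then 1 else 0))"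
proof -
  have "has_dslope (\<lambda>t. \<Sum>i<length xs. of_int (int (p!i)) * max 0 (t - xs!i)) t 1
      (\<Sum>i<length xs. int (p!i) * (if xs!i \<le> t then 1 else 0))"
    by (intro has_dslope_sum has_dslope_cmult has_dslope_hinge_right)
  then show ?thesis by (simp add: ramp_def[abs_def])
qed

lemma ramp_left_slope:
  "has_dslope (ramp p xs) t (- 1) (\<Sum>i<length xs. int (p!i) * (if xs!i < t then - 1 else 0))"
proof -
  have "has_dslope (\<lambda>t. \<Sum>i<length xs. of_int (int (p!i)) * max 0 (t - xs!i)) t (- 1)
      (\<Sum>i<length xs. int (p!i) * (if xs!i < t then - 1 else 0))"
    by (intro has_dslope_sum has_dslope_cmult has_dslope_hinge_left)
  then show ?thesis by (simp add: ramp_def[abs_def])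
qed

text \<open>A chip exactly at \<open>t\<close> counts for the right slope but not for the left one;
  every other chip contributes opposite amounts to the two outgoing slopes.\<close>

lemma ramp_kink: "dslope (ramp p xs) t 1 + dslope (ramp p xs) t (- 1) = mass_at p xs t"
  unfolding dslope_eq[OF ramp_right_slope] dslope_eq[OF ramp_left_slope] mass_at_def
    sum.distrib[symmetric]
  by (intro sum.cong) auto

lemma pl_int_ramp: "0 < M \<Longrightarrow> pl_int M (ramp p xs)"
  unfolding pl_int_iff_dslopes using ramp_right_slope ramp_left_slope by blast

lemma sum_list_eq_sum_nth:
  "length xs = length p \<Longrightarrow> sum_list p = (\<Sum>i<length xs. p!i)"
  by (simp add: sum_list_sum_nth atLeast0LessThan)

context
  fixes M :: real and p :: "nat list" and xs :: "real list"
  assumes placed: "placed M p xs"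
begin

lemma placed_nth: "i < length xs \<Longrightarrow> 0 < xs!i" "i < length xs \<Longrightarrow> xs!i < M"
  using placed unfolding placed_def by auto

lemma ramp_at_0: "ramp p xs 0 = 0"
  unfolding ramp_def using placed_nth(1) by (intro sum.neutral) (fastforce simp: max_def)

text \<open>At \<open>M\<close> all hinges are active, so the value sees only the number of chips
  and their moment. Two placements that share both therefore have ramps with equal end
  values.\<close>

lemma ramp_at_end: "ramp p xs M = real (sum_list p) * M - moment p xs"
proof -
  have "ramp p xs M = (\<Sum>i<length xs. real (p!i) * (M - xs!i))"
    unfolding ramp_def using placed_nth(2) by (intro sum.cong) (auto simp: max_def less_imp_le)
  also have "\<dots> = real (sum_list p) * M - moment p xs"
    using placed unfolding placed_def moment_def
    by (simp add: sum_list_eq_sum_nth[of xs] right_diff_distrib sum_subtractf sum_distrib_right)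
  finally show ?thesis .
qed

lemma dslope_ramp_0: "dslope (ramp p xs) 0 1 = 0"
  unfolding dslope_eq[OF ramp_right_slope] using placed_nth(1)
  by (intro sum.neutral) fastforce

lemma dslope_ramp_end: "dslope (ramp p xs) M (- 1) = - int (sum_list p)"
proof -
  have "(\<Sum>i<length xs. int (p!i) * (if xs!i < M then - 1 else 0)) = (\<Sum>i<length xs. - int (p!i))"
    using placed_nth(2) by (intro sum.cong) auto
  then show ?thesis unfolding dslope_eq[OF ramp_left_slope]
    using placed by (simp add: placed_def sum_list_eq_sum_nth[of xs] sum_negf)
qed

end

lemma sum_list_pos_iff:
  assumes "\<forall>k\<in>set p. 0 < (k::nat)"
  shows "0 < sum_list p \<longleftrightarrow> p \<noteq> []"
  using assms by (cases p) auto

text \<open>A mean with positive weights of points of an open interval stays in that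
  interval.\<close>

lemma centroid:
  assumes "placed M p xs" "p \<noteq> []"
  shows "\<exists>x. 0 < x \<and> x < M \<and> moment p xs = real (sum_list p) * x"
proof -
  note xs = placed_nth[OF assms(1)]
  have len: "length xs = length p" and pos: "\<forall>k\<in>set p. 0 < k"
    using assms(1) unfolding placed_def by auto
  have S: "0 < sum_list p" using sum_list_pos_iff[OF pos] assms(2) by simp
  have pp: "0 < real (p!i)" if "i < length xs" for i using pos len that by auto
  have ne: "{..<length xs} \<noteq> {}" using len assms(2) by auto
  have "0 < moment p xs" unfolding moment_def
    by (intro sum_pos ne) (use pp xs in auto)
  moreover have "moment p xs < (\<Sum>i<length xs. real (p!i) * M)" unfolding moment_def
    by (intro sum_strict_mono ne) (use pp xs in auto)
  then have "moment p xs < real (sum_list p) * M"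
    by (simp add: sum_list_eq_sum_nth[OF len] sum_distrib_right)
  moreover obtain S' where "real (sum_list p) = S'" "0 < S'"
    using S by (metis of_nat_0_less_iff)
  ultimately show ?thesis
    by (intro exI[of _ "moment p xs / S'"]) (simp add: divide_less_eq mult.commute)
qed

lemma ex_placed_centroid:
  assumes pos: "\<forall>k\<in>set p. 0 < k" and ne: "p \<noteq> []" and x: "0 < x" "x < M"
  shows "\<exists>xs. placed M p xs \<and> moment p xs = real (sum_list p) * x"
proof -
  define n where "n = length p"
  define S where "S = real (sum_list p)"
  \<comment> \<open>\<open>c\<close> is the weighted mean of the indices. Placing part
    \<open>i\<close> at x + \<epsilon> (i - c) then gives centre of mass \<open>x\<close> for every
    spacing \<epsilon>.\<close>
  define c where "c = (\<Sum>i<n. real (p!i) * real i) / S"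
  have S: "0 < S" using sum_list_pos_iff[OF pos] ne unfolding S_def by simp
  have Ssum: "S = (\<Sum>i<n. real (p!i))"
    unfolding S_def n_def by (simp add: sum_list_eq_sum_nth[of p p])
  have c0: "0 \<le> c" unfolding c_def using S by (intro divide_nonneg_pos sum_nonneg) auto
  have "(\<Sum>i<n. real (p!i) * real i) \<le> (\<Sum>i<n. real (p!i) * real n)"
    by (intro sum_mono mult_left_mono) auto
  also have "\<dots> = real n * S" by (simp add: Ssum sum_distrib_left mult.commute)
  finally have cn: "c \<le> real n"
    unfolding c_def using S by (simp only: pos_divide_le_eq)
  \<comment> \<open>As 0 \<le> c \<le> n, every offset i - c is smaller than n + 1 in absolute
    value, so with this spacing all parts stay closer to \<open>x\<close> than either end of the
    edge.\<close>
  define \<epsilon> where "\<epsilon> = min x (M - x) / (real n + 1)"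
  have \<epsilon>: "0 < \<epsilon>" "\<epsilon> * (real n + 1) = min x (M - x)" unfolding \<epsilon>_def using x by auto
  define xs where "xs = map (\<lambda>i. x + \<epsilon> * (real i - c)) [0..<n]"
  have bound: "0 < x + \<epsilon> * (real i - c) \<and> x + \<epsilon> * (real i - c) < M" if "i < n" for i
  proof -
    have "\<bar>real i - c\<bar> < real n + 1" using c0 cn that by (auto simp: abs_less_iff)
    then have "\<bar>\<epsilon> * (real i - c)\<bar> < min x (M - x)"
      unfolding \<epsilon>(2)[symmetric] abs_mult using \<epsilon>(1) by simp
    then show ?thesis by (auto simp: abs_less_iff)
  qed
  have "placed M p xs"
    unfolding placed_def xs_def using pos bound \<epsilon>(1)
    by (auto simp: n_def sorted_wrt_iff_nth_less)
  moreover have "moment p xs = S * x"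
  proof -
    have "moment p xs = (\<Sum>i<n. real (p!i) * (x + \<epsilon> * (real i - c)))"
      unfolding moment_def xs_def by simp
    also have "\<dots> = (\<Sum>i<n. real (p!i)) * x + \<epsilon> * ((\<Sum>i<n. real (p!i) * real i) - (\<Sum>i<n. real (p!i)) * c)"
      by (simp add: algebra_simps sum.distrib sum_subtractf sum_distrib_left sum_distrib_right)
    also have "(\<Sum>i<n. real (p!i)) * c = (\<Sum>i<n. real (p!i) * real i)"
      unfolding Ssum[symmetric] c_def using S by simp
    finally show ?thesis using Ssum by simp
  qed
  ultimately show ?thesis unfolding S_def by blast
qed

text \<open>The parts of \<open>q\<close> are packed around the centre of mass of \<open>p\<close>.
  Having no chips at all forces both lists to be empty.\<close>

lemma replace_partition:
  assumes "placed M p xs" "\<forall>k\<in>set q. 0 < k" "sum_list q = sum_list p"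
  shows "\<exists>ys. placed M q ys \<and> moment q ys = moment p xs"
proof (cases "p = []")
  case True
  then have "sum_list q = 0" using assms(3) by simp
  then have "q = []" using sum_list_pos_iff[OF assms(2)] by (metis less_irrefl)
  with True assms(1) show ?thesis
    by (intro exI[of _ "[]"]) (simp add: placed_def moment_def)
next
  case False
  have pos: "\<forall>k\<in>set p. 0 < k" using assms(1) unfolding placed_def by (rule conjunct1)
  have "0 < sum_list q" unfolding assms(3) sum_list_pos_iff[OF pos] by (rule False)
  then have "q \<noteq> []" unfolding sum_list_pos_iff[OF assms(2)] .
  moreover obtain x where "0 < x" "x < M" "moment p xs = real (sum_list p) * x"
    using centroid[OF assms(1) False] by blast
  ultimately show ?thesis
    using ex_placed_centroid[OF assms(2), of x M] assms(3) by simp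
qed

lemma mass_at_nth:
  assumes "placed M p xs" "i < length xs"
  shows "mass_at p xs (xs!i) = int (p!i)"
proof -
  have d: "distinct xs" using assms(1) unfolding placed_def strict_sorted_iff by blast
  have "mass_at p xs (xs!i) = (\<Sum>j<length xs. if j = i then int (p!j) else 0)"
    unfolding mass_at_def using d assms(2) by (intro sum.cong) (auto simp: nth_eq_iff_index_eq)
  then show ?thesis using assms(2) by simp
qed

lemma placed_support:
  assumes "placed M p xs"
  shows "set xs = {t. 0 < t \<and> t < M \<and> 0 < mass_at p xs t}"
proof (intro set_eqI iffI)
  fix t assume "t \<in> set xs"
  then obtain i where "i < length xs" "t = xs!i" by (auto simp: in_set_conv_nth)
  then show "t \<in> {t. 0 < t \<and> t < M \<and> 0 < mass_at p xs t}"
    using mass_at_nth[OF assms] assms by (auto simp: placed_def)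
next
  fix t assume "t \<in> {t. 0 < t \<and> t < M \<and> 0 < mass_at p xs t}"
  then have "(\<Sum>i<length xs. if xs!i = t then int (p!i) else 0) \<noteq> 0"
    unfolding mass_at_def by auto
  then obtain i where "i < length xs" "xs!i = t"
    by (rule sum.not_neutral_contains_not_neutral) (auto split: if_splits)
  then show "t \<in> set xs" by auto
qed

text \<open>The places of positive mass recover the set of positions, hence the strictly sorted
  list, and the masses at these places recover the parts.\<close>

lemma mass_at_unique:
  assumes "placed M p xs" "placed M q ys" "\<And>t. 0 < t \<Longrightarrow> t < M \<Longrightarrow> mass_at p xs t = mass_at q ys t"
  shows "p = q"
proof -
  have "set xs = set ys"
    unfolding placed_support[OF assms(1)] placed_support[OF assms(2)] using assms(3) by auto
  then have xy: "xs = ys"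
    using strict_sorted_equal[of ys xs] assms(1,2) unfolding placed_def by blast
  show "p = q"
  proof (rule nth_equalityI)
    show "length p = length q" using assms(1,2) xy unfolding placed_def by simp
    fix i assume "i < length p"
    then have i: "i < length xs" using assms(1) unfolding placed_def by simp
    have "int (p!i) = int (q!i)"
      using mass_at_nth[OF assms(1) i] mass_at_nth[OF assms(2), of i] i xy
        assms(3)[OF placed_nth[OF assms(1) i]] by simp
    then show "p!i = q!i" by simp
  qed
qed

lemma in_cell_iff:
  "in_cell G D (d, p, m) L \<longleftrightarrow> L \<in> linsys G D \<and> (\<forall>v\<in>verts G. L (Vert v) = int (d v)) \<and>
     (\<forall>e\<in>edges G. \<exists>xs. placed (elen G e) (p e) xs \<and>
        (\<forall>t. 0 < t \<and> t < elen G e \<longrightarrow> L (Inner e t) = mass_at (p e) xs t)) \<and>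
     (\<forall>f\<in>RD G D. L = (\<lambda>x. D x + prin_div G f x) \<longrightarrow> (\<forall>e\<in>edges G. dslope (edge_fun G f e) 0 1 = m e))"
  by (simp add: in_cell_def placed_def mass_at_def)

section \<open>Moving chips within the edges\<close>

lemma pl_int_pos: "pl_int M \<phi> \<Longrightarrow> 0 < M"
  unfolding pl_int_iff_dslopes by blast

lemma edge_fun_add: "edge_fun G (\<lambda>x. f x + h x) e = (\<lambda>t. edge_fun G f e t + edge_fun G h e t)"
  unfolding edge_fun_def ..

lemma dslope_add:
  assumes "pl_int M \<phi>" "pl_int M \<psi>"
  shows "0 \<le> t \<Longrightarrow> t < M \<Longrightarrow> dslope (\<lambda>x. \<phi> x + \<psi> x) t 1 = dslope \<phi> t 1 + dslope \<psi> t 1"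
    and "0 < t \<Longrightarrow> t \<le> M \<Longrightarrow> dslope (\<lambda>x. \<phi> x + \<psi> x) t (- 1) = dslope \<phi> t (- 1) + dslope \<psi> t (- 1)"
  by (rule dslope_eq, intro has_dslope_add pl_int_has_dslope[OF assms(1)] pl_int_has_dslope[OF assms(2)]; assumption)+

lemma dslope_diff:
  assumes "pl_int M \<phi>" "pl_int M \<psi>"
  shows "0 \<le> t \<Longrightarrow> t < M \<Longrightarrow> dslope (\<lambda>x. \<phi> x - \<psi> x) t 1 = dslope \<phi> t 1 - dslope \<psi> t 1"
    and "0 < t \<Longrightarrow> t \<le> M \<Longrightarrow> dslope (\<lambda>x. \<phi> x - \<psi> x) t (- 1) = dslope \<phi> t (- 1) - dslope \<psi> t (- 1)"
  by (rule dslope_eq, intro has_dslope_diff pl_int_has_dslope[OF assms(1)] pl_int_has_dslope[OF assms(2)]; assumption)+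

lemma pl_int_add:
  assumes "pl_int M \<phi>" "pl_int M \<psi>"
  shows "pl_int M (\<lambda>x. \<phi> x + \<psi> x)"
  by (subst pl_int_iff_dslopes)
    (auto intro!: exI has_dslope_add pl_int_has_dslope[OF assms(1)] pl_int_has_dslope[OF assms(2)] pl_int_pos[OF assms(1)])

lemma pl_int_diff:
  assumes "pl_int M \<phi>" "pl_int M \<psi>"
  shows "pl_int M (\<lambda>x. \<phi> x - \<psi> x)"
  by (subst pl_int_iff_dslopes)
    (auto intro!: exI has_dslope_diff pl_int_has_dslope[OF assms(1)] pl_int_has_dslope[OF assms(2)] pl_int_pos[OF assms(1)])

lemma rational_function_add:
  "rational_function G f \<Longrightarrow> rational_function G h \<Longrightarrow> rational_function G (\<lambda>x. f x + h x)"
  unfolding rational_function_def edge_fun_add using pl_int_add by blast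

lemma prin_div_add:
  assumes "rational_function G f" "rational_function G h"
  shows "prin_div G (\<lambda>x. f x + h x) x = prin_div G f x + prin_div G h x"
proof (cases "x \<in> gpoints G")
  case True
  have pl: "pl_int (elen G e) (edge_fun G f e)" "pl_int (elen G e) (edge_fun G h e)" if "e \<in> edges G" for e
    using assms that unfolding rational_function_def by blast+
  note add = dslope_add[OF pl]
  have pos: "0 < elen G e" if "e \<in> edges G" for e using pl_int_pos[OF pl(1)[OF that]] .
  have "ord G (\<lambda>x. f x + h x) x = ord G f x + ord G h x"
  proof (cases x)
    case (Vert v)
    have "(\<Sum>e\<in>{e\<in>edges G. esrc G e = v}. dslope (\<lambda>t. edge_fun G f e t + edge_fun G h e t) 0 1)
       = (\<Sum>e\<in>{e\<in>edges G. esrc G e = v}. dslope (edge_fun G f e) 0 1 + dslope (edge_fun G h e) 0 1)"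
      using pos by (intro sum.cong refl add) auto
    moreover have "(\<Sum>e\<in>{e\<in>edges G. etgt G e = v}. dslope (\<lambda>t. edge_fun G f e t + edge_fun G h e t) (elen G e) (- 1))
       = (\<Sum>e\<in>{e\<in>edges G. etgt G e = v}. dslope (edge_fun G f e) (elen G e) (- 1) + dslope (edge_fun G h e) (elen G e) (- 1))"
      using pos by (intro sum.cong refl add) auto
    ultimately show ?thesis
      unfolding ord_def edge_fun_add Vert by (simp add: sum.distrib)
  next
    case (Inner e t)
    with True have "e \<in> edges G" "0 < t" "t < elen G e" unfolding gpoints_def by auto
    then show ?thesis unfolding ord_def edge_fun_add Inner using add[of e t] by simp
  qed
  with True show ?thesis unfolding prin_div_def by simp
qed (simp add: prin_div_def)

text \<open>Keeping the number and the centre of mass of the chips inside an edge is what makes the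
  difference of the two ramp functions vanish near both ends of the edge.\<close>
definition rearranged ::
  "('v,'e) mgraph \<Rightarrow> (('v,'e) gpoint \<Rightarrow> int) \<Rightarrow> (('v,'e) gpoint \<Rightarrow> int) \<Rightarrow> bool" where
  "rearranged G L N \<longleftrightarrow>
     (\<forall>x. (\<nexists>e t. x = Inner e t \<and> e \<in> edges G \<and> 0 < t \<and> t < elen G e) \<longrightarrow> N x = L x) \<and>
     (\<exists>p xs q ys. \<forall>e\<in>edges G. placed (elen G e) (p e) (xs e) \<and> placed (elen G e) (q e) (ys e) \<and>
        sum_list (p e) = sum_list (q e) \<and> moment (p e) (xs e) = moment (q e) (ys e) \<and>
        (\<forall>t. 0 < t \<and> t < elen G e \<longrightarrow>
           L (Inner e t) = mass_at (p e) (xs e) t \<and> N (Inner e t) = mass_at (q e) (ys e) t))"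

lemma rearranged_sym:
  assumes "rearranged G L N"
  shows "rearranged G N L"
proof -
  from assms obtain p xs q ys where "\<forall>e\<in>edges G. placed (elen G e) (p e) (xs e) \<and>
        placed (elen G e) (q e) (ys e) \<and>
        sum_list (p e) = sum_list (q e) \<and> moment (p e) (xs e) = moment (q e) (ys e) \<and>
        (\<forall>t. 0 < t \<and> t < elen G e \<longrightarrow>
           L (Inner e t) = mass_at (p e) (xs e) t \<and> N (Inner e t) = mass_at (q e) (ys e) t)"
    unfolding rearranged_def by (elim exE conjE)
  then have "\<exists>p xs q ys. \<forall>e\<in>edges G. placed (elen G e) (p e) (xs e) \<and> placed (elen G e) (q e) (ys e) \<and>
        sum_list (p e) = sum_list (q e) \<and> moment (p e) (xs e) = moment (q e) (ys e) \<and>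
        (\<forall>t. 0 < t \<and> t < elen G e \<longrightarrow>
           N (Inner e t) = mass_at (p e) (xs e) t \<and> L (Inner e t) = mass_at (q e) (ys e) t)"
    by (intro exI[of _ q] exI[of _ ys] exI[of _ p] exI[of _ xs]) simp
  moreover have "\<forall>x. (\<nexists>e t. x = Inner e t \<and> e \<in> edges G \<and> 0 < t \<and> t < elen G e) \<longrightarrow> L x = N x"
    using assms unfolding rearranged_def by metis
  ultimately show ?thesis unfolding rearranged_def by (rule conjI[rotated])
qed

lemma rearranged_principal:
  assumes "metric_graph G" "rearranged G L N"
  shows "\<exists>h. rational_function G h \<and> (\<forall>x. N x = L x + prin_div G h x) \<and>
    (\<forall>e\<in>edges G. dslope (edge_fun G h e) 0 1 = 0)"
proof -
  from assms(2) obtain p xs q ys where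
    eq: "\<forall>x. (\<nexists>e t. x = Inner e t \<and> e \<in> edges G \<and> 0 < t \<and> t < elen G e) \<longrightarrow> N x = L x" and
    *: "\<forall>e\<in>edges G. placed (elen G e) (p e) (xs e) \<and> placed (elen G e) (q e) (ys e) \<and>
        sum_list (p e) = sum_list (q e) \<and> moment (p e) (xs e) = moment (q e) (ys e) \<and>
        (\<forall>t. 0 < t \<and> t < elen G e \<longrightarrow>
           L (Inner e t) = mass_at (p e) (xs e) t \<and> N (Inner e t) = mass_at (q e) (ys e) t)"
    unfolding rearranged_def by (elim exE conjE)
  define H where "H e t = ramp (q e) (ys e) t - ramp (p e) (xs e) t" for e t
  \<comment> \<open>The value 0 at the vertices fits the edges: both ramps vanish at the source, and
    at the target they agree because totals and moments do. Since \<open>h\<close> follows the ramps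
    at every \<open>Inner e t\<close>, the identity \<open>ef\<close> below holds for all real
    \<open>t\<close>.\<close>
  define h :: "('a,'b) gpoint \<Rightarrow> real"
    where "h x = (case x of Vert v \<Rightarrow> 0 | Inner e t \<Rightarrow> H e t)" for x
  have pos: "0 < elen G e" if "e \<in> edges G" for e
    using assms(1) that unfolding metric_graph_def by blast
  have ef: "edge_fun G h e = (\<lambda>t. ramp (q e) (ys e) t - ramp (p e) (xs e) t)" if e: "e \<in> edges G" for e
  proof
    fix t
    have "placed (elen G e) (p e) (xs e)" "placed (elen G e) (q e) (ys e)" using * e by auto
    note r = ramp_at_0[OF this(1)] ramp_at_0[OF this(2)] ramp_at_end[OF this(1)] ramp_at_end[OF this(2)]
    show "edge_fun G h e t = ramp (q e) (ys e) t - ramp (p e) (xs e) t"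
      using bspec[OF * e] r by (simp add: edge_fun_def pt_of_def h_def H_def)
  qed
  note pl = pl_int_ramp[OF pos]
  have rat: "rational_function G h"
    unfolding rational_function_def using pl_int_diff[OF pl pl] by (simp add: ef)
  have s0: "dslope (edge_fun G h e) 0 1 = 0" if e: "e \<in> edges G" for e
  proof -
    have "placed (elen G e) (p e) (xs e)" "placed (elen G e) (q e) (ys e)" using * e by auto
    then show ?thesis
      unfolding ef[OF e] using dslope_diff(1)[OF pl[OF e] pl[OF e] order_refl pos[OF e]]
      by (simp add: dslope_ramp_0)
  qed
  have sM: "dslope (edge_fun G h e) (elen G e) (- 1) = 0" if e: "e \<in> edges G" for e
  proof -
    have "placed (elen G e) (p e) (xs e)" "placed (elen G e) (q e) (ys e)" using * e by auto
    then show ?thesis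
      unfolding ef[OF e] using dslope_diff(2)[OF pl[OF e] pl[OF e] pos[OF e] order_refl]
        bspec[OF * e] by (simp add: dslope_ramp_end)
  qed
  have "N x = L x + prin_div G h x" for x
  proof (cases "\<exists>e t. x = Inner e t \<and> e \<in> edges G \<and> 0 < t \<and> t < elen G e")
    case True
    then obtain e t where x: "x = Inner e t" "e \<in> edges G" "0 < t" "t < elen G e" by blast
    then have "prin_div G h x = dslope (edge_fun G h e) t 1 + dslope (edge_fun G h e) t (- 1)"
      unfolding prin_div_def gpoints_def by (auto simp: ord_def)
    also have "\<dots> = mass_at (q e) (ys e) t - mass_at (p e) (xs e) t"
      unfolding ef[OF x(2)] using dslope_diff[OF pl[OF x(2)] pl[OF x(2)]] x
        ramp_kink[of "q e" "ys e" t] ramp_kink[of "p e" "xs e" t] by simp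
    finally show ?thesis using bspec[OF * x(2)] x by simp
  next
    case False
    have "prin_div G h x = 0"
    proof (cases x)
      case (Vert v)
      then show ?thesis unfolding prin_div_def ord_def by (simp add: s0 sM)
    next
      case (Inner e t)
      then show ?thesis using False unfolding prin_div_def gpoints_def by auto
    qed
    then show ?thesis using eq False by simp
  qed
  with rat s0 show ?thesis by blast
qed

text \<open>The slope condition of a cell speaks of every function representing the divisor, so the
  move is needed in both directions. Adding \<open>h\<close> to a function for \<open>L\<close>
  shows that \<open>N\<close> lies in |D|. Adding \<open>k\<close> to an arbitrary \<open>g\<close>
  for \<open>N\<close> gives a function for \<open>L\<close> with the same slopes at the sources,
  and these are known from \<open>L\<close>.\<close>

lemma in_cell_rearranged:
  assumes "metric_graph G" and L: "in_cell G D (d, p, m) L" and re: "rearranged G L N"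
    and ys: "\<forall>e\<in>edges G. placed (elen G e) (q e) (ys e) \<and>
        (\<forall>t. 0 < t \<and> t < elen G e \<longrightarrow> N (Inner e t) = mass_at (q e) (ys e) t)"
    and eff: "effective N"
  shows "in_cell G D (d, q, m) N"
proof -
  obtain h where h: "rational_function G h" "\<And>x. N x = L x + prin_div G h x"
    using rearranged_principal[OF assms(1) re] by blast
  obtain k where k: "rational_function G k" "\<And>x. L x = N x + prin_div G k x"
    "\<And>e. e \<in> edges G \<Longrightarrow> dslope (edge_fun G k e) 0 1 = 0"
    using rearranged_principal[OF assms(1) rearranged_sym[OF re]] by blast
  have Leff: "effective L" using L unfolding in_cell_def linsys_def RD_def by auto
  have lin: "N \<in> linsys G D"
  proof -
    obtain f where f: "f \<in> RD G D" "L = (\<lambda>x. D x + prin_div G f x)"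
      using L unfolding in_cell_def linsys_def by auto
    have rf: "rational_function G f" using f(1) unfolding RD_def by blast
    have N: "N = (\<lambda>x. D x + prin_div G (\<lambda>x. f x + h x) x)"
      using h(2) f(2) prin_div_add[OF rf h(1)] by (auto simp: fun_eq_iff)
    then have "(\<lambda>x. f x + h x) \<in> RD G D"
      using eff rational_function_add[OF rf h(1)] unfolding RD_def by simp
    then show ?thesis using N unfolding linsys_def by blast
  qed
  have slopes: "dslope (edge_fun G g e) 0 1 = m e"
    if g: "g \<in> RD G D" "N = (\<lambda>x. D x + prin_div G g x)" and e: "e \<in> edges G" for g e
  proof -
    have rg: "rational_function G g" using g(1) unfolding RD_def by blast
    have L': "L = (\<lambda>x. D x + prin_div G (\<lambda>x. g x + k x) x)"
      using k(2) g(2) prin_div_add[OF rg k(1)] by (auto simp: fun_eq_iff)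
    then have "(\<lambda>x. g x + k x) \<in> RD G D"
      using Leff rational_function_add[OF rg k(1)] unfolding RD_def by simp
    then have "dslope (edge_fun G (\<lambda>x. g x + k x) e) 0 1 = m e"
      using L L' e unfolding in_cell_def by blast
    moreover have "pl_int (elen G e) (edge_fun G g e)" "pl_int (elen G e) (edge_fun G k e)"
      using rg k(1) e unfolding rational_function_def by auto
    ultimately show ?thesis
      unfolding edge_fun_add using dslope_add(1)[of _ _ _ 0] pl_int_pos k(3)[OF e] by fastforce
  qed
  have "N (Vert v) = L (Vert v)" for v
    using re unfolding rearranged_def by blast
  then show ?thesis
    using L lin slopes ys unfolding in_cell_iff by auto
qed

lemma in_cell_change_partition:
  assumes "metric_graph G" and L: "in_cell G D (d, p, m) L"
    and q: "\<And>e. e \<in> edges G \<Longrightarrow> (\<forall>k\<in>set (q e). 0 < k) \<and> sum_list (q e) = sum_list (p e)"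
  shows "\<exists>N. in_cell G D (d, q, m) N"
proof -
  have "\<forall>e\<in>edges G. \<exists>xs. placed (elen G e) (p e) xs \<and>
        (\<forall>t. 0 < t \<and> t < elen G e \<longrightarrow> L (Inner e t) = mass_at (p e) xs t)"
    using L unfolding in_cell_iff by blast
  then obtain xs where xs: "\<forall>e\<in>edges G. placed (elen G e) (p e) (xs e) \<and>
        (\<forall>t. 0 < t \<and> t < elen G e \<longrightarrow> L (Inner e t) = mass_at (p e) (xs e) t)"
    by (elim bchoice[THEN exE])
  then have "\<forall>e\<in>edges G. \<exists>ys. placed (elen G e) (q e) ys \<and> moment (q e) ys = moment (p e) (xs e)"
    using replace_partition q by blast
  then obtain ys where ys: "\<forall>e\<in>edges G. placed (elen G e) (q e) (ys e) \<and>
      moment (q e) (ys e) = moment (p e) (xs e)"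
    by (elim bchoice[THEN exE])
  \<comment> \<open>Values of the datatype that are not points of the graph keep the coefficient of
    \<open>L\<close>, because divisors are compared as functions on the whole type.\<close>
  define N where "N x = (case x of Vert v \<Rightarrow> L x
    | Inner e t \<Rightarrow> if e \<in> edges G \<and> 0 < t \<and> t < elen G e then mass_at (q e) (ys e) t else L x)" for x
  have N: "\<And>e t. e \<in> edges G \<Longrightarrow> 0 < t \<Longrightarrow> t < elen G e \<Longrightarrow> N (Inner e t) = mass_at (q e) (ys e) t"
    unfolding N_def by simp
  have eq: "N x = L x" if "\<nexists>e t. x = Inner e t \<and> e \<in> edges G \<and> 0 < t \<and> t < elen G e" for x
    using that unfolding N_def by (cases x) auto
  have re: "rearranged G L N"
    unfolding rearranged_def
    by (intro conjI allI impI exI[of _ p] exI[of _ xs] exI[of _ q] exI[of _ ys] eq)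
      (use xs ys q N in auto)
  have Leff: "effective L" using L unfolding in_cell_def linsys_def RD_def by auto
  have eff: "effective N" unfolding effective_def
  proof
    fix x
    show "0 \<le> N x"
      using Leff unfolding N_def effective_def mass_at_def
      by (auto split: gpoint.split intro!: sum_nonneg)
  qed
  show ?thesis
    using in_cell_rearranged[OF assms(1) L re, of q ys] ys N eff by blast
qed

text \<open>This supplies the slope that the cell data leave out. Since \<open>D\<close> has no
  interior chips, the chips of \<open>L\<close> inside \<open>e\<close> are exactly the kinks of
  \<open>f\<close> there. Subtracting their ramp removes them, so the end slopes of the difference
  cancel; the ramp itself has outgoing slope 0 at the source and minus the number of chips at the
  target.\<close>

lemma in_cell_end_slope:
  assumes "vertex_supported G D" and L: "in_cell G D (d, p, m) L"
    and f: "f \<in> RD G D" "L = (\<lambda>x. D x + prin_div G f x)" and e: "e \<in> edges G"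
  shows "dslope (edge_fun G f e) (elen G e) (- 1) = - m e - int (sum_list (p e))"
proof -
  obtain xs where xs: "placed (elen G e) (p e) xs"
    "\<And>t. 0 < t \<Longrightarrow> t < elen G e \<Longrightarrow> L (Inner e t) = mass_at (p e) xs t"
    using L e unfolding in_cell_iff by blast
  have m: "dslope (edge_fun G f e) 0 1 = m e" using L f e unfolding in_cell_iff by blast
  have pl: "pl_int (elen G e) (edge_fun G f e)"
    using f(1) e unfolding RD_def rational_function_def by blast
  note pos = pl_int_pos[OF pl]
  note plr = pl_int_ramp[OF pos, of "p e" xs]
  let ?\<psi> = "\<lambda>t. edge_fun G f e t - ramp (p e) xs t"
  note diff = dslope_diff[OF pl plr]
  have "dslope ?\<psi> t 1 + dslope ?\<psi> t (- 1) = 0" if t: "0 < t" "t < elen G e" for t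
  proof -
    have "D (Inner e t) = 0" using assms(1) unfolding vertex_supported_def by auto
    then have "L (Inner e t) = dslope (edge_fun G f e) t 1 + dslope (edge_fun G f e) t (- 1)"
      using t e unfolding f(2) prin_div_def gpoints_def by (auto simp: ord_def)
    then show ?thesis
      using diff[of t] t xs(2)[OF t] ramp_kink[of "p e" xs t] by simp
  qed
  from end_slopes_cancel[OF pl_int_diff[OF pl plr] this]
  show ?thesis
    using diff(1)[OF order_refl pos] diff(2)[OF pos order_refl] m
      dslope_ramp_0[OF xs(1)] dslope_ramp_end[OF xs(1)] by simp
qed

section \<open>Components of the cut graph\<close>

definition edge_step :: "('v,'e) mgraph \<Rightarrow> 'e set \<Rightarrow> 'v \<Rightarrow> 'v \<Rightarrow> bool" where
  "edge_step G F a b \<longleftrightarrow> (\<exists>e\<in>F. (a = esrc G e \<and> b = etgt G e) \<or> (a = etgt G e \<and> b = esrc G e))"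

text \<open>The connected component of \<open>v\<close> in the graph that keeps only the edges
  \<open>F\<close>. Below, \<open>F\<close> consists of the edges without chips, since every other
  edge is cut.\<close>

definition vertex_class :: "('v,'e) mgraph \<Rightarrow> 'e set \<Rightarrow> 'v \<Rightarrow> 'v set" where
  "vertex_class G F v = {w. (edge_step G F)\<^sup>*\<^sup>* v w}"

lemma vertex_class_eq_iff: "vertex_class G F u = vertex_class G F v \<longleftrightarrow> (edge_step G F)\<^sup>*\<^sup>* u v"
proof
  assume "vertex_class G F u = vertex_class G F v"
  then have "v \<in> vertex_class G F u" by (simp add: vertex_class_def)
  then show "(edge_step G F)\<^sup>*\<^sup>* u v" by (simp add: vertex_class_def)
next
  assume uv: "(edge_step G F)\<^sup>*\<^sup>* u v"
  have "symp (edge_step G F)" by (rule sympI) (auto simp: edge_step_def)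
  then have "(edge_step G F)\<^sup>*\<^sup>* v u" using uv by (rule sympD[OF symp_rtranclp])
  with uv show "vertex_class G F u = vertex_class G F v"
    unfolding vertex_class_def by (intro Collect_cong iffI) (erule (1) rtranclp_trans)+
qed

lemma gstep_sym:
  assumes "gstep G I x y"
  shows "gstep G I y x"
proof -
  from assms obtain e s t where "e \<in> edges G" "0 \<le> s" "s \<le> elen G e" "0 \<le> t" "t \<le> elen G e"
    "x = pt_of G e s" "y = pt_of G e t" "\<forall>u. min s t \<le> u \<and> u \<le> max s t \<longrightarrow> pt_of G e u \<notin> I"
    unfolding gstep_def by (elim bexE exE conjE)
  then show ?thesis unfolding gstep_def min.commute[of s] max.commute[of s]
    by (intro bexI[of _ e] exI[of _ t] exI[of _ s] conjI)
qed

lemma gstep_rtranclp_sym: "(gstep G I)\<^sup>*\<^sup>* x y \<Longrightarrow> (gstep G I)\<^sup>*\<^sup>* y x"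
  by (rule sympD[OF symp_rtranclp[OF sympI]]) (rule gstep_sym)

section \<open>Labels that classify the components of the graph cut at finitely many points\<close>

context
  fixes G :: "('v,'e) mgraph" and xs :: "'e \<Rightarrow> real list" and I :: "('v,'e) gpoint set"
  assumes G: "metric_graph G"
    and sorted: "\<And>e. e \<in> edges G \<Longrightarrow> sorted_wrt (<) (xs e)"
    and range: "\<And>e x. e \<in> edges G \<Longrightarrow> x \<in> set (xs e) \<Longrightarrow> 0 < x \<and> x < elen G e"
    and I: "I = {Inner e t | e t. e \<in> edges G \<and> t \<in> set (xs e)}"
begin

definition "uncut = {e \<in> edges G. xs e = []}"

definition "below e t = card {x \<in> set (xs e). x < t}"

text \<open>\<open>Inr (e, k)\<close> stands for the open piece of \<open>e\<close> between its \<open>k\<close>-th and \<open>(k+1)\<close>-st cut;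
  the outer pieces belong to the components of the end vertices.\<close>
definition "edge_label e t =
  (if below e t = 0 then Inl (vertex_class G uncut (esrc G e))
   else if below e t = length (xs e) then Inl (vertex_class G uncut (etgt G e))
   else Inr (e, below e t))"

text \<open>A complete invariant of components: steps preserve it (\<open>label_gstep\<close>), and
  points with equal labels are connected (\<open>label_eq_imp_connected\<close>). Counting
  components thus becomes counting labels.\<close>

definition "label x = (case x of Vert v \<Rightarrow> Inl (vertex_class G uncut v) | Inner e t \<Rightarrow> edge_label e t)"

lemma len_pos: "e \<in> edges G \<Longrightarrow> 0 < elen G e"
  using G unfolding metric_graph_def by blast

lemma ends_in: "e \<in> edges G \<Longrightarrow> esrc G e \<in> verts G \<and> etgt G e \<in> verts G"
  using G unfolding metric_graph_def by blast

lemma card_xs: "e \<in> edges G \<Longrightarrow> card (set (xs e)) = length (xs e)"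
  using sorted[of e] by (simp add: strict_sorted_iff distinct_card)

lemma below_0: "e \<in> edges G \<Longrightarrow> below e 0 = 0"
  using range[of e] unfolding below_def by fastforce

lemma below_end: "e \<in> edges G \<Longrightarrow> below e (elen G e) = length (xs e)"
proof -
  assume e: "e \<in> edges G"
  then have "{x \<in> set (xs e). x < elen G e} = set (xs e)" using range by blast
  then show ?thesis unfolding below_def by (simp add: card_xs[OF e])
qed

text \<open>On an edge without cuts both outer cases of \<open>edge_label\<close> apply at once;
  this makes them agree.\<close>

lemma vertex_class_uncut:
  assumes "e \<in> edges G" "xs e = []"
  shows "vertex_class G uncut (esrc G e) = vertex_class G uncut (etgt G e)"
  unfolding vertex_class_eq_iff
  by (rule r_into_rtranclp) (use assms in \<open>auto simp: edge_step_def uncut_def\<close>)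

lemma label_pt_of:
  assumes "e \<in> edges G"
  shows "label (pt_of G e t) = edge_label e t"
  using below_0[OF assms] below_end[OF assms] vertex_class_uncut[OF assms] len_pos[OF assms]
  unfolding pt_of_def label_def edge_label_def by auto

lemma in_I_iff: "pt_of G e t \<in> I \<longleftrightarrow> e \<in> edges G \<and> t \<in> set (xs e)"
  using range unfolding I pt_of_def by force

text \<open>A segment that misses all cuts has the same cuts below both of its ends.\<close>

lemma label_gstep:
  assumes "gstep G I x y"
  shows "label x = label y"
proof -
  obtain e s t where e: "e \<in> edges G" and xy: "x = pt_of G e s" "y = pt_of G e t"
    and seg: "\<And>u. min s t \<le> u \<Longrightarrow> u \<le> max s t \<Longrightarrow> pt_of G e u \<notin> I"
    using assms unfolding gstep_def by blast
  have "u < s \<longleftrightarrow> u < t" if "u \<in> set (xs e)" for u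
    using seg[of u] that e unfolding in_I_iff by linarith
  then have "below e s = below e t" unfolding below_def by metis
  then show ?thesis unfolding xy label_pt_of[OF e] edge_label_def by simp
qed

lemma label_gstep_rtranclp: "(gstep G I)\<^sup>*\<^sup>* x y \<Longrightarrow> label x = label y"
  by (induction rule: rtranclp_induct) (auto dest: label_gstep)

text \<open>A cut between \<open>s\<close> and \<open>t\<close> would lie below the larger of them
  only, so the two counts would differ.\<close>

lemma gstep_on_edge:
  assumes e: "e \<in> edges G" and "0 \<le> s" "s \<le> elen G e" "0 \<le> t" "t \<le> elen G e"
    and notin: "s \<notin> set (xs e)" "t \<notin> set (xs e)" and b: "below e s = below e t"
  shows "gstep G I (pt_of G e s) (pt_of G e t)"
proof -
  have *: "u \<notin> set (xs e)" if st: "s \<le> t" "below e s = below e t" "s \<notin> set (xs e)" "t \<notin> set (xs e)"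
    and u: "s \<le> u" "u \<le> t" for s t u
  proof
    assume ux: "u \<in> set (xs e)"
    have "{x \<in> set (xs e). x < s} \<subset> {x \<in> set (xs e). x < t}"
    proof (rule psubsetI)
      show "{x \<in> set (xs e). x < s} \<subseteq> {x \<in> set (xs e). x < t}" using st(1) by auto
      have "u \<noteq> t" using ux st(4) by blast
      then have "u \<in> {x \<in> set (xs e). x < t}" using ux u(2) by simp
      moreover have "u \<notin> {x \<in> set (xs e). x < s}" using u(1) by simp
      ultimately show "{x \<in> set (xs e). x < s} \<noteq> {x \<in> set (xs e). x < t}" by blast
    qed
    then have "below e s < below e t" unfolding below_def by (intro psubset_card_mono) auto
    with st show False by simp
  qed
  have "pt_of G e u \<notin> I" if "min s t \<le> u" "u \<le> max s t" for u
    using *[of s t u] *[of t s u] that b notin unfolding in_I_iff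
    by (cases "s \<le> t") (auto simp: min_def max_def)
  then show ?thesis unfolding gstep_def using assms(1-5)
    by (intro bexI[of _ e] exI[of _ s] exI[of _ t]) simp_all
qed

lemma not_in_ends: "e \<in> edges G \<Longrightarrow> 0 \<notin> set (xs e) \<and> elen G e \<notin> set (xs e)"
  using range by fastforce

lemma point_cases:
  assumes "x \<in> gpoints G - I"
  obtains v where "v \<in> verts G" "x = Vert v"
  | e t where "e \<in> edges G" "0 < t" "t < elen G e" "t \<notin> set (xs e)" "x = pt_of G e t" "x = Inner e t"
  using assms unfolding gpoints_def I pt_of_def by auto

text \<open>A label \<open>Inl c\<close> on an edge marks an outer piece: it runs to the source when
  no cut lies below the point, and to the target when all cuts do.\<close>

lemma to_vertex:
  assumes "x \<in> gpoints G - I" "label x = Inl c"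
  shows "\<exists>v\<in>verts G. (gstep G I)\<^sup>*\<^sup>* x (Vert v) \<and> vertex_class G uncut v = c"
  using assms(1)
proof (cases rule: point_cases)
  case (1 v)
  then show ?thesis using assms(2) by (auto simp: label_def)
next
  case (2 e t)
  have src: "pt_of G e 0 = Vert (esrc G e)" and tgt: "pt_of G e (elen G e) = Vert (etgt G e)"
    using len_pos[OF 2(1)] by (auto simp: pt_of_def)
  show ?thesis
  proof (cases "below e t = 0")
    case True
    then have "gstep G I x (Vert (esrc G e))"
      unfolding src[symmetric] 2(5)
      using 2 below_0[OF 2(1)] not_in_ends[OF 2(1)] len_pos[OF 2(1)] by (intro gstep_on_edge) auto
    then show ?thesis using True assms(2) ends_in[OF 2(1)]
      by (intro bexI[of _ "esrc G e"]) (auto simp: 2(6) label_def edge_label_def)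
  next
    case False
    then have len: "below e t = length (xs e)" using assms(2) 2(6)
      by (auto simp: label_def edge_label_def split: if_splits)
    then have "gstep G I x (Vert (etgt G e))"
      unfolding tgt[symmetric] 2(5)
      using 2 below_end[OF 2(1)] not_in_ends[OF 2(1)] len_pos[OF 2(1)] by (intro gstep_on_edge) auto
    then show ?thesis using False len assms(2) ends_in[OF 2(1)]
      by (intro bexI[of _ "etgt G e"]) (auto simp: 2(6) label_def edge_label_def)
  qed
qed

lemma edge_step_gstep:
  assumes "edge_step G uncut a b"
  shows "gstep G I (Vert a) (Vert b)"
proof -
  obtain e where e: "e \<in> edges G" "xs e = []"
    and ab: "(a = esrc G e \<and> b = etgt G e) \<or> (a = etgt G e \<and> b = esrc G e)"
    using assms unfolding edge_step_def uncut_def by blast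
  have "pt_of G e 0 = Vert (esrc G e)" "pt_of G e (elen G e) = Vert (etgt G e)"
    using len_pos[OF e(1)] by (auto simp: pt_of_def)
  moreover have "gstep G I (pt_of G e 0) (pt_of G e (elen G e))"
    using e len_pos[OF e(1)] by (intro gstep_on_edge) (auto simp: below_def)
  ultimately show ?thesis using ab gstep_sym by metis
qed

lemma vertex_class_gstep:
  assumes "vertex_class G uncut u = vertex_class G uncut v"
  shows "(gstep G I)\<^sup>*\<^sup>* (Vert u) (Vert v)"
proof -
  have "(edge_step G uncut)\<^sup>*\<^sup>* u v" using assms unfolding vertex_class_eq_iff .
  then show ?thesis
    by (induction rule: rtranclp_induct) (auto intro: rtranclp.rtrancl_into_rtrancl edge_step_gstep)
qed

lemma label_eq_imp_connected:
  assumes "x \<in> gpoints G - I" "y \<in> gpoints G - I" "label x = label y"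
  shows "(gstep G I)\<^sup>*\<^sup>* x y"
proof (cases "label x")
  case (Inl c)
  obtain u where u: "(gstep G I)\<^sup>*\<^sup>* x (Vert u)" "vertex_class G uncut u = c"
    using to_vertex[OF assms(1) Inl] by blast
  obtain v where v: "(gstep G I)\<^sup>*\<^sup>* y (Vert v)" "vertex_class G uncut v = c"
    using to_vertex[OF assms(2)] Inl assms(3) by metis
  have "(gstep G I)\<^sup>*\<^sup>* (Vert u) (Vert v)" using vertex_class_gstep u(2) v(2) by simp
  then show ?thesis using u(1) gstep_rtranclp_sym[OF v(1)] by (meson rtranclp_trans)
next
  case (Inr c)
  have ne: "z \<noteq> Vert v" if "label z = Inr c" for z v using that by (auto simp: label_def)
  have "x \<noteq> Vert v" "y \<noteq> Vert v" for v using ne Inr assms(3) by metis+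
  then obtain e t e' t' where
    x: "e \<in> edges G" "0 < t" "t < elen G e" "t \<notin> set (xs e)" "x = pt_of G e t" "x = Inner e t" and
    y: "e' \<in> edges G" "0 < t'" "t' < elen G e'" "t' \<notin> set (xs e')" "y = pt_of G e' t'" "y = Inner e' t'"
    using point_cases[OF assms(1)] point_cases[OF assms(2)] by metis
  have c: "c = (e, below e t)" "c = (e', below e' t')"
    using Inr assms(3) unfolding x(6) y(6) by (auto simp: label_def edge_label_def split: if_splits)
  then have "gstep G I x y"
    unfolding x(5) y(5) using x y by (auto intro!: gstep_on_edge)
  then show ?thesis by blast
qed

lemma label_image:
  "label ` (gpoints G - I) = Inl ` vertex_class G uncut ` verts G \<union>
     Inr ` (SIGMA e:edges G. {1..<length (xs e)})" (is "?A = ?B")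
proof (intro equalityI subsetI)
  fix l assume "l \<in> ?A"
  then obtain x where x: "x \<in> gpoints G - I" "l = label x" by blast
  show "l \<in> ?B"
  proof (cases l)
    case (Inl c)
    then show ?thesis using to_vertex[OF x(1), of c] x(2) by auto
  next
    case (Inr c)
    have "x \<noteq> Vert v" for v using Inr x(2) by (auto simp: label_def)
    then obtain e t where e: "e \<in> edges G" "x = Inner e t"
      using x(1) by (meson point_cases)
    have "below e t \<le> length (xs e)"
      unfolding below_def card_xs[OF e(1), symmetric] by (intro card_mono) auto
    then show ?thesis using Inr x(2) e
      by (auto simp: label_def edge_label_def split: if_splits)
  qed
next
  fix l assume "l \<in> ?B"
  then show "l \<in> ?A"
  proof
    assume "l \<in> Inl ` vertex_class G uncut ` verts G"
    then obtain v where v: "v \<in> verts G" "l = Inl (vertex_class G uncut v)" by blast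
    have "Vert v \<in> gpoints G - I" using v unfolding gpoints_def I by auto
    moreover have "l = label (Vert v)" using v by (simp add: label_def)
    ultimately show ?thesis by blast
  next
    assume "l \<in> Inr ` (SIGMA e:edges G. {1..<length (xs e)})"
    then obtain e k where e: "e \<in> edges G" and k: "0 < k" "k < length (xs e)" "l = Inr (e, k)"
      by (auto simp: Suc_le_eq)
    note less = sorted_wrt_nth_less[OF sorted[OF e]]
    have mono: "xs e ! i \<le> xs e ! j" if "i \<le> j" "j < length (xs e)" for i j
      using less[of i j] that by (cases "i = j") auto
    \<comment> \<open>The midpoint of two consecutive cuts. With indices starting at 0, exactly the
      \<open>k\<close> cuts with indices below \<open>k\<close> precede it, so it realises the label
      \<open>Inr (e, k)\<close>.\<close>
    define t where "t = (xs e ! (k - 1) + xs e ! k) / 2"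
    have t: "xs e ! (k - 1) < t" "t < xs e ! k" using less[of "k - 1" k] k unfolding t_def by auto
    have side: "xs e ! i < t \<longleftrightarrow> i < k" "xs e ! i \<noteq> t" if "i < length (xs e)" for i
      using mono[of i "k - 1"] mono[of k i] t k that by (cases "i < k"; force)+
    have "{x \<in> set (xs e). x < t} = (\<lambda>i. xs e ! i) ` {..<k}"
    proof (intro equalityI subsetI)
      fix x assume "x \<in> (\<lambda>i. xs e ! i) ` {..<k}"
      then obtain i where "i < k" "x = xs e ! i" by blast
      then show "x \<in> {x \<in> set (xs e). x < t}" using side(1)[of i] k by simp
    qed (use side in \<open>auto simp: in_set_conv_nth\<close>)
    moreover have "inj_on (\<lambda>i. xs e ! i) {..<k}"
      using sorted[OF e] k by (auto simp: inj_on_def strict_sorted_iff nth_eq_iff_index_eq)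
    ultimately have bt: "below e t = k" unfolding below_def by (simp add: card_image)
    have "xs e ! (k - 1) \<in> set (xs e)" "xs e ! k \<in> set (xs e)" using k by auto
    then have "0 < t" "t < elen G e" using range[OF e] t by fastforce+
    moreover have "t \<notin> set (xs e)" using side by (auto simp: in_set_conv_nth)
    ultimately have "Inner e t \<in> gpoints G - I" using e unfolding gpoints_def I by auto
    moreover have "l = label (Inner e t)" using k bt by (simp add: label_def edge_label_def)
    ultimately show ?thesis by blast
  qed
qed

text \<open>The first summand counts the components that contain a vertex, the second the inner
  pieces. Truncated subtraction gives the right count 0 for edges without cuts.\<close>

lemma card_components_aux:
  "card (components G I) = card (vertex_class G {e \<in> edges G. xs e = []} ` verts G) + (\<Sum>e\<in>edges G. length (xs e) - 1)"
proof -
  have fin: "finite (verts G)" "finite (edges G)" using G unfolding metric_graph_def by blast+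
  let ?P = "gpoints G - I"
  have "components G I = (\<lambda>l. {y \<in> ?P. l = label y}) ` (label ` ?P)"
    unfolding components_def image_image
  proof (intro image_cong refl Collect_cong conj_cong)
    fix x y assume "x \<in> ?P" "y \<in> ?P"
    then show "(x = y \<or> (gstep G I)\<^sup>*\<^sup>* x y) = (label x = label y)"
      using label_eq_imp_connected label_gstep_rtranclp by blast
  qed
  moreover have "inj_on (\<lambda>l. {y \<in> ?P. l = label y}) (label ` ?P)"
    by (rule inj_onI) blast
  ultimately have "card (components G I) = card (label ` ?P)" by (simp add: card_image)
  also have "\<dots> = card (vertex_class G uncut ` verts G) + card (SIGMA e:edges G. {1..<length (xs e)})"
    unfolding label_image using fin
    by (subst card_Un_disjoint) (auto simp: card_image)
  finally show ?thesis using fin by (simp add: uncut_def)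
qed

end

lemma card_components:
  assumes G: "metric_graph G" and L: "in_cell G D (d, p, m) L"
  shows "card (components G (interior_supp G L)) =
    card (vertex_class G {e \<in> edges G. p e = []} ` verts G) + (\<Sum>e\<in>edges G. length (p e) - 1)"
proof -
  have "\<forall>e\<in>edges G. \<exists>xs. placed (elen G e) (p e) xs \<and>
        (\<forall>t. 0 < t \<and> t < elen G e \<longrightarrow> L (Inner e t) = mass_at (p e) xs t)"
    using L unfolding in_cell_iff by blast
  then obtain xs where xs: "\<forall>e\<in>edges G. placed (elen G e) (p e) (xs e) \<and>
        (\<forall>t. 0 < t \<and> t < elen G e \<longrightarrow> L (Inner e t) = mass_at (p e) (xs e) t)"
    by (elim bchoice[THEN exE])
  have len: "length (xs e) = length (p e)" if "e \<in> edges G" for e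
    using xs that unfolding placed_def by blast
  have supp: "set (xs e) = {t. 0 < t \<and> t < elen G e \<and> 0 < L (Inner e t)}" if "e \<in> edges G" for e
    using placed_support[of "elen G e" "p e" "xs e"] xs that by auto
  have "interior_supp G L = {Inner e t | e t. e \<in> edges G \<and> t \<in> set (xs e)}"
    unfolding interior_supp_def gpoints_def using supp by auto
  moreover have "sorted_wrt (<) (xs e)" if "e \<in> edges G" for e
    using xs that unfolding placed_def by blast
  moreover have "0 < x \<and> x < elen G e" if "e \<in> edges G" "x \<in> set (xs e)" for e x
    using supp that by blast
  ultimately have "card (components G (interior_supp G L)) =
    card (vertex_class G {e \<in> edges G. xs e = []} ` verts G) + (\<Sum>e\<in>edges G. length (xs e) - 1)"
    using card_components_aux[OF G, of xs] by simp
  moreover have "{e \<in> edges G. xs e = []} = {e \<in> edges G. p e = []}"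
    using len by (metis (lifting) length_0_conv)
  ultimately show ?thesis using len by simp
qed

section \<open>Counting compositions\<close>

definition compositions :: "nat \<Rightarrow> nat list set" where
  "compositions n = {p. (\<forall>k\<in>set p. 0 < k) \<and> sum_list p = n}"

lemma length_le_sum_list: "\<forall>k\<in>set p. 0 < (k::nat) \<Longrightarrow> length p \<le> sum_list p"
  by (induction p) auto

lemma finite_compositions: "finite (compositions n)"
proof (rule finite_subset)
  show "compositions n \<subseteq> {p. set p \<subseteq> {..n} \<and> length p \<le> n}"
    unfolding compositions_def using length_le_sum_list member_le_sum_list by fastforce
qed (simp add: finite_lists_length_le)

lemma sum_list_map_Suc: "sum_list (map Suc l) = sum_list l + length l"
  by (induction l) auto

text \<open>Lowering each of the \<open>j + 1\<close> parts by one leaves a list of naturals with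
  sum n - (j + 1), and such lists are counted by stars and bars. With truncated subtraction
  \<open>n = 0\<close> behaves like \<open>n = 1\<close>: a single composition, of excess 0. Edges
  without chips can therefore stay in all later sums and products.\<close>

lemma card_compositions_length:
  "card {p \<in> compositions n. length p - 1 = j} = (n - 1) choose j"
proof (cases "n = 0")
  case True
  have "p \<in> compositions 0 \<longleftrightarrow> p \<in> {[]}" for p
    unfolding compositions_def by (cases p) auto
  then have "compositions n = {[]}" unfolding True by (rule set_eqI)
  then have "card {p \<in> compositions n. length p - 1 = j} = card {p \<in> {[]::nat list}. length p - 1 = j}"
    by (rule ssubst) (rule refl)
  also have "{p \<in> {[]::nat list}. length p - 1 = j} = (if j = 0 then {[]} else {})"
    by (cases "j = 0") auto
  finally show ?thesis unfolding True by (cases "j = 0") simp_all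
next
  case False
  define S where "S = {l::nat list. length l = j + 1 \<and> sum_list l = n - (j + 1)}"
  show ?thesis
  proof (cases "j + 1 \<le> n")
    case True
    have "{p \<in> compositions n. length p - 1 = j} = map Suc ` S"
    proof (intro equalityI subsetI)
      fix p assume p: "p \<in> {p \<in> compositions n. length p - 1 = j}"
      then have pos: "\<forall>k\<in>set p. 0 < k" and sum: "sum_list p = n" and len: "length p - 1 = j"
        unfolding compositions_def by blast+
      have "0 < sum_list p" using sum \<open>n \<noteq> 0\<close> by linarith
      then have "0 < length p" unfolding sum_list_pos_iff[OF pos] length_greater_0_conv .
      then have len: "length p = j + 1" using len by linarith
      have eq: "map Suc (map (\<lambda>k. k - 1) p) = p" unfolding map_map by (intro map_idI) (use pos in auto)
      have "sum_list p = sum_list (map (\<lambda>k. k - 1) p) + length p"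
        using sum_list_map_Suc[of "map (\<lambda>k. k - 1) p"] unfolding eq length_map .
      then have "sum_list (map (\<lambda>k. k - 1) p) = n - (j + 1)" using sum len by linarith
      then have "map (\<lambda>k. k - 1) p \<in> S" unfolding S_def using len by simp
      then show "p \<in> map Suc ` S" by (rule image_eqI[where f = "map Suc", OF eq[symmetric]])
    next
      fix p assume "p \<in> map Suc ` S"
      then obtain l where "p = map Suc l" "length l = j + 1" "sum_list l = n - (j + 1)"
        unfolding S_def by (elim imageE CollectE conjE)
      then show "p \<in> {p \<in> compositions n. length p - 1 = j}"
        using True by (simp add: compositions_def sum_list_map_Suc)
    qed
    moreover have "inj_on (map Suc) S" by (rule inj_on_subset[OF _ subset_UNIV]) simp
    ultimately have "card {p \<in> compositions n. length p - 1 = j} = card S"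
      by (simp add: card_image)
    also have "\<dots> = (n - (j + 1) + (j + 1) - 1) choose (n - (j + 1))"
      unfolding S_def by (rule card_length_sum_list)
    also have "\<dots> = (n - 1) choose j"
    proof -
      have "n - (j + 1) = n - 1 - j" "n - (j + 1) + (j + 1) - 1 = n - 1" "j \<le> n - 1"
        using True by linarith+
      then show ?thesis using binomial_symmetric by metis
    qed
    finally show ?thesis .
  next
    case False
    have "length p - 1 \<noteq> j" if "p \<in> compositions n" for p
    proof -
      have "length p \<le> n" using that length_le_sum_list[of p] unfolding compositions_def by blast
      then show ?thesis using False \<open>n \<noteq> 0\<close> by linarith
    qed
    then have "{p \<in> compositions n. length p - 1 = j} = {}" by blast
    moreover have "n - 1 < j" using False \<open>n \<noteq> 0\<close> by linarith
    ultimately show ?thesis by (simp only: card.empty binomial_eq_0)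
  qed
qed

text \<open>Values outside \<open>E\<close> are pinned to \<open>[]\<close>, so a family of
  compositions is one function and distinct families differ on \<open>E\<close>.\<close>

definition composition_families :: "'e set \<Rightarrow> ('e \<Rightarrow> nat) \<Rightarrow> ('e \<Rightarrow> nat list) set" where
  "composition_families E c = {p. (\<forall>e\<in>E. p e \<in> compositions (c e)) \<and> (\<forall>e. e \<notin> E \<longrightarrow> p e = [])}"

lemma composition_families_insert:
  assumes "e \<notin> F"
  shows "composition_families (insert e F) c =
    (\<lambda>(l, p). p(e := l)) ` (compositions (c e) \<times> composition_families F c)"
proof (intro equalityI subsetI)
  fix p assume p: "p \<in> composition_families (insert e F) c"
  have "(p e, p(e := [])) \<in> compositions (c e) \<times> composition_families F c"
    using p assms unfolding composition_families_def by auto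
  moreover have "p = (\<lambda>(l, p). p(e := l)) (p e, p(e := []))" by simp
  ultimately show "p \<in> (\<lambda>(l, p). p(e := l)) ` (compositions (c e) \<times> composition_families F c)" by blast
qed (use assms in \<open>auto simp: composition_families_def\<close>)

lemma finite_composition_families: "finite E \<Longrightarrow> finite (composition_families E c)"
proof (induction E rule: finite_induct)
  case empty
  have "composition_families {} c = {\<lambda>_. []}" unfolding composition_families_def by auto
  then show ?case by simp
qed (simp add: composition_families_insert finite_compositions)

text \<open>Induction on the edges: splitting according to the excess \<open>k\<close> on the new
  edge gives a sum of products of binomial coefficients, which Vandermonde's identity
  evaluates.\<close>

lemma card_composition_families:
  assumes "finite E"
  shows "card {p \<in> composition_families E c. (\<Sum>e\<in>E. length (p e) - 1) = j} = (\<Sum>e\<in>E. c e - 1) choose j"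
  using assms
proof (induction E arbitrary: j rule: finite_induct)
  case empty
  have "{p \<in> composition_families {} c. (\<Sum>e\<in>{}. length (p e) - 1) = j} =
      (if j = 0 then {\<lambda>_. []} else {})"
    unfolding composition_families_def by auto
  then show ?case by simp
next
  case (insert e F)
  let ?A = "\<lambda>k. {l \<in> compositions (c e). length l - 1 = k}"
  let ?P = "\<lambda>k. {p \<in> composition_families F c. (\<Sum>e\<in>F. length (p e) - 1) = k}"
  let ?upd = "\<lambda>(k, l, p). (p(e := l))"
  have sum_upd: "(\<Sum>x\<in>F. length ((p(e := l)) x) - 1) = (\<Sum>x\<in>F. length (p x) - 1)" for p and l :: "nat list"
    using insert.hyps by (intro sum.cong) auto
  have "{p \<in> composition_families (insert e F) c. (\<Sum>e\<in>insert e F. length (p e) - 1) = j} =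
      ?upd ` (SIGMA k:{..j}. ?A k \<times> ?P (j - k))" (is "?L = ?R")
  proof (intro equalityI subsetI)
    fix p assume p: "p \<in> ?L"
    then obtain l p' where lp: "p = p'(e := l)" "l \<in> compositions (c e)" "p' \<in> composition_families F c"
      unfolding composition_families_insert[OF insert.hyps(2)] by auto
    have "length l - 1 + (\<Sum>x\<in>F. length (p' x) - 1) = j"
      using p insert.hyps unfolding lp(1) by (simp add: sum_upd[simplified])
    then have "(length l - 1, l, p') \<in> (SIGMA k:{..j}. ?A k \<times> ?P (j - k))"
      using lp(2,3) by auto
    then show "p \<in> ?R" using lp(1) by (intro image_eqI[of _ _ "(length l - 1, l, p')"]) simp_all
  next
    fix p assume "p \<in> ?R"
    then obtain k l p' where lp: "p = p'(e := l)" "k \<le> j" "l \<in> ?A k" "p' \<in> ?P (j - k)" by auto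
    then show "p \<in> ?L"
      unfolding composition_families_insert[OF insert.hyps(2)]
      using insert.hyps by (auto simp: sum_upd[simplified])
  qed
  moreover have "inj_on ?upd (SIGMA k:{..j}. ?A k \<times> ?P (j - k))"
  proof (rule inj_onI)
    fix x y assume x: "x \<in> (SIGMA k:{..j}. ?A k \<times> ?P (j - k))"
      and y: "y \<in> (SIGMA k:{..j}. ?A k \<times> ?P (j - k))" and eq: "?upd x = ?upd y"
    obtain k l p k' l' p' where xy: "x = (k, l, p)" "y = (k', l', p')" by (metis prod_cases3)
    have upd: "p(e := l) = p'(e := l')" using eq xy by simp
    then have l: "l = l'" by (metis fun_upd_same)
    \<comment> \<open>Both families are empty at \<open>e\<close> before the update, so resetting
      that value recovers them.\<close>
    have "p e = []" "p' e = []" using x y xy insert.hyps(2) by (auto simp: composition_families_def)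
    then have "p = p'" using upd by (metis fun_upd_triv fun_upd_upd)
    then show "x = y" using l x y xy by auto
  qed
  ultimately have "card ?L = card (SIGMA k:{..j}. ?A k \<times> ?P (j - k))"
    by (simp only: card_image)
  also have "\<dots> = (\<Sum>k\<le>j. card (?A k \<times> ?P (j - k)))"
    using finite_compositions finite_composition_families[OF insert.hyps(1)] by (intro card_SigmaI) auto
  also have "\<dots> = (\<Sum>k\<le>j. ((c e - 1) choose k) * ((\<Sum>e\<in>F. c e - 1) choose (j - k)))"
    by (simp only: card_cartesian_product card_compositions_length insert.IH)
  also have "\<dots> = ((c e - 1) + (\<Sum>e\<in>F. c e - 1)) choose j" by (rule vandermonde)
  finally show ?case using insert.hyps by simp
qed

lemma card_all_composition_families:
  assumes "finite E"
  shows "card (composition_families E c) = 2 ^ (\<Sum>e\<in>E. c e - 1)"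
proof -
  let ?s = "\<Sum>e\<in>E. c e - 1"
  let ?P = "\<lambda>k. {p \<in> composition_families E c. (\<Sum>e\<in>E. length (p e) - 1) = k}"
  have "(\<Sum>e\<in>E. length (p e) - 1) \<le> ?s" if "p \<in> composition_families E c" for p
  proof (rule sum_mono)
    fix e assume "e \<in> E"
    then have "p e \<in> compositions (c e)" using that unfolding composition_families_def by blast
    then show "length (p e) - 1 \<le> c e - 1"
      using length_le_sum_list[of "p e"] unfolding compositions_def by (auto intro: diff_le_mono)
  qed
  then have "composition_families E c = (\<Union>k\<le>?s. ?P k)" by auto
  also have "card \<dots> = (\<Sum>k\<le>?s. card (?P k))"
    using finite_composition_families[OF assms] by (intro card_UN_disjoint) auto
  also have "\<dots> = 2 ^ ?s" by (simp only: card_composition_families[OF assms] choose_row_sum)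
  finally show ?thesis .
qed

section \<open>Cells and their anchor cells\<close>

lemma in_cell_positions:
  assumes "in_cell G D (d, p, m) L" "e \<in> edges G"
  shows "\<exists>xs. placed (elen G e) (p e) xs \<and> (\<forall>t. 0 < t \<and> t < elen G e \<longrightarrow> L (Inner e t) = mass_at (p e) xs t)"
  using assms unfolding in_cell_iff by blast

lemma in_cell_pos:
  assumes "in_cell G D (d, p, m) L" "e \<in> edges G"
  shows "\<forall>k\<in>set (p e). 0 < k"
  using in_cell_positions[OF assms] unfolding placed_def by blast

text \<open>Cells are sets, while fibres are counted through data; this makes the two
  interchangeable for nonempty cells.\<close>

lemma cell_data_unique:
  assumes L: "in_cell G D (d, p, m) L" "in_cell G D (d', p', m') L"
  shows "\<forall>v\<in>verts G. d v = d' v" "\<forall>e\<in>edges G. p e = p' e" "\<forall>e\<in>edges G. m e = m' e"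
proof -
  show "\<forall>v\<in>verts G. d v = d' v"
    using L unfolding in_cell_iff by (metis of_nat_eq_iff)
  show "\<forall>e\<in>edges G. p e = p' e"
  proof
    fix e assume e: "e \<in> edges G"
    obtain xs where xs: "placed (elen G e) (p e) xs"
      "\<And>t. 0 < t \<Longrightarrow> t < elen G e \<Longrightarrow> L (Inner e t) = mass_at (p e) xs t"
      using in_cell_positions[OF L(1) e] by blast
    obtain ys where ys: "placed (elen G e) (p' e) ys"
      "\<And>t. 0 < t \<Longrightarrow> t < elen G e \<Longrightarrow> L (Inner e t) = mass_at (p' e) ys t"
      using in_cell_positions[OF L(2) e] by blast
    show "p e = p' e"
      by (rule mass_at_unique[OF xs(1) ys(1)]) (simp only: xs(2)[symmetric] ys(2)[symmetric])
  qed
  \<comment> \<open>The slope condition is universally quantified over \<open>f\<close>, so it pins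
    down \<open>m\<close> only once some \<open>f\<close> represents \<open>L\<close>; membership in
    |D| provides one.\<close>
  obtain f where "f \<in> RD G D" "L = (\<lambda>x. D x + prin_div G f x)"
    using L(1) unfolding in_cell_iff linsys_def by blast
  then show "\<forall>e\<in>edges G. m e = m' e"
    using L unfolding in_cell_iff by metis
qed

lemma cell_of_cong:
  assumes "\<And>v. v \<in> verts G \<Longrightarrow> d v = d' v" "\<And>e. e \<in> edges G \<Longrightarrow> p e = p' e"
    "\<And>e. e \<in> edges G \<Longrightarrow> m e = m' e"
  shows "cell_of G D (d, p, m) = cell_of G D (d', p', m')"
  unfolding cell_of_def in_cell_iff using assms by (simp cong: ball_cong)

lemma cell_of_eq_imp:
  assumes "cell_of G D (d, p, m) = cell_of G D (d', p', m')" "cell_of G D (d, p, m) \<noteq> {}"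
  shows "\<forall>v\<in>verts G. d v = d' v" "\<forall>e\<in>edges G. p e = p' e" "\<forall>e\<in>edges G. m e = m' e"
proof -
  obtain L where "in_cell G D (d, p, m) L" "in_cell G D (d', p', m') L"
    using assms unfolding cell_of_def by blast
  from cell_data_unique[OF this]
  show "\<forall>v\<in>verts G. d v = d' v" "\<forall>e\<in>edges G. p e = p' e" "\<forall>e\<in>edges G. m e = m' e" .
qed

lemma cells_cases:
  assumes "C \<in> cells G D"
  obtains d p m where "C = cell_of G D (d, p, m)" "cell_of G D (d, p, m) \<noteq> {}"
  using assms unfolding cells_def by auto

lemma in_cells: "cell_of G D c \<noteq> {} \<Longrightarrow> cell_of G D c \<in> cells G D"
  unfolding cells_def by blast

text \<open>The number of parts on an edge is the number of interior points with positive
  coefficient. Being an anchor divisor is thus read off from the data and is shared by all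
  representatives of a cell.\<close>

lemma anchor_div_iff:
  assumes L: "in_cell G D (d, p, m) L"
  shows "anchor_div G L \<longleftrightarrow> (\<forall>e\<in>edges G. length (p e) \<le> 1)"
  unfolding anchor_div_def
proof (intro ball_cong refl)
  fix e assume e: "e \<in> edges G"
  obtain xs where xs: "placed (elen G e) (p e) xs"
    "\<And>t. 0 < t \<Longrightarrow> t < elen G e \<Longrightarrow> L (Inner e t) = mass_at (p e) xs t"
    using in_cell_positions[OF L e] by blast
  have supp: "set xs = {t. 0 < t \<and> t < elen G e \<and> 0 < L (Inner e t)}"
    unfolding placed_support[OF xs(1)] using xs(2) by auto
  have "length (p e) = card (set xs)"
    using xs(1) unfolding placed_def strict_sorted_iff by (simp add: distinct_card)
  moreover have "card (set xs) \<le> 1 \<longleftrightarrow> (\<forall>s\<in>set xs. \<forall>t\<in>set xs. s = t)"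
    by (simp add: card_le_Suc0_iff_eq)
  ultimately show "(\<forall>s t. 0 < s \<and> s < elen G e \<and> 0 < t \<and> t < elen G e \<and>
      L (Inner e s) > 0 \<and> L (Inner e t) > 0 \<longrightarrow> s = t) = (length (p e) \<le> 1)"
    unfolding supp by auto
qed

lemma anchor_cells_iff:
  assumes "cell_of G D (d, p, m) \<noteq> {}"
  shows "cell_of G D (d, p, m) \<in> anchor_cells G D \<longleftrightarrow> (\<forall>e\<in>edges G. length (p e) \<le> 1)"
proof -
  have "(\<forall>L\<in>cell_of G D (d, p, m). anchor_div G L) \<longleftrightarrow> (\<forall>e\<in>edges G. length (p e) \<le> 1)"
    using assms anchor_div_iff unfolding cell_of_def by blast
  then show ?thesis using in_cells[OF assms] unfolding anchor_cells_def by blast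
qed

text \<open>An edge without chips keeps the empty list, because \<open>[0]\<close> would have a part
  that is not positive.\<close>

definition merge :: "('e \<Rightarrow> nat list) \<Rightarrow> 'e \<Rightarrow> nat list" where
  "merge p e = (if p e = [] then [] else [sum_list (p e)])"

lemma sum_list_merge: "sum_list (merge p e) = sum_list (p e)"
  by (simp add: merge_def)

lemma merge_pos: "\<forall>k\<in>set (p e). 0 < k \<Longrightarrow> \<forall>k\<in>set (merge p e). 0 < k"
  unfolding merge_def using sum_list_pos_iff[of "p e"] by (simp only: set_simps split: if_split) blast

text \<open>The map takes a set of divisors, so data have to be chosen for it;
  \<open>anchor_of_cell\<close> shows that all data of a nonempty cell give the same result.\<close>

definition anchor_of :: "('v,'e) mgraph \<Rightarrow> (('v,'e) gpoint \<Rightarrow> int) \<Rightarrow> (('v,'e) gpoint \<Rightarrow> int) set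
    \<Rightarrow> (('v,'e) gpoint \<Rightarrow> int) set" where
  "anchor_of G D C = (SOME A. \<exists>d p m. C = cell_of G D (d, p, m) \<and> A = cell_of G D (d, merge p, m))"

lemma anchor_of_cell:
  assumes "cell_of G D (d, p, m) \<noteq> {}"
  shows "anchor_of G D (cell_of G D (d, p, m)) = cell_of G D (d, merge p, m)"
  unfolding anchor_of_def
proof (rule some_equality)
  show "\<exists>d' p' m'. cell_of G D (d, p, m) = cell_of G D (d', p', m') \<and>
      cell_of G D (d, merge p, m) = cell_of G D (d', merge p', m')"
    by blast
next
  fix A assume "\<exists>d' p' m'. cell_of G D (d, p, m) = cell_of G D (d', p', m') \<and>
      A = cell_of G D (d', merge p', m')"
  then obtain d' p' m' where *: "cell_of G D (d, p, m) = cell_of G D (d', p', m')"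
    and A: "A = cell_of G D (d', merge p', m')" by blast
  show "A = cell_of G D (d, merge p, m)"
    unfolding A using cell_of_eq_imp[OF * assms]
    by (intro cell_of_cong) (simp_all add: merge_def)
qed

lemma change_partition_nonempty:
  assumes "metric_graph G" "cell_of G D (d, p, m) \<noteq> {}"
    and "\<And>e. e \<in> edges G \<Longrightarrow> (\<forall>k\<in>set (q e). 0 < k) \<and> sum_list (q e) = sum_list (p e)"
  shows "cell_of G D (d, q, m) \<noteq> {}"
proof -
  obtain L where L: "in_cell G D (d, p, m) L" using assms(2) unfolding cell_of_def by blast
  from in_cell_change_partition[OF assms(1) L assms(3)] show ?thesis
    unfolding cell_of_def by blast
qed

lemma merge_nonempty:
  assumes "metric_graph G" "cell_of G D (d, p, m) \<noteq> {}"
  shows "cell_of G D (d, merge p, m) \<noteq> {}"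
proof -
  obtain L where L: "in_cell G D (d, p, m) L" using assms(2) unfolding cell_of_def by blast
  show ?thesis
    by (intro change_partition_nonempty[OF assms] conjI merge_pos in_cell_pos[OF L] sum_list_merge)
qed

lemma cell_dim_eq:
  assumes "metric_graph G" "cell_of G D (d, p, m) \<noteq> {}"
  shows "cell_dim G (cell_of G D (d, p, m)) =
    card (vertex_class G {e \<in> edges G. p e = []} ` verts G) + (\<Sum>e\<in>edges G. length (p e) - 1) - 1"
proof -
  have "(SOME L. L \<in> cell_of G D (d, p, m)) \<in> cell_of G D (d, p, m)"
    using assms(2) by (simp add: some_in_eq)
  then have "in_cell G D (d, p, m) (SOME L. L \<in> cell_of G D (d, p, m))"
    unfolding cell_of_def by simp
  from card_components[OF assms(1) this] show ?thesis unfolding cell_dim_def by simp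
qed

text \<open>With at most one part, that part is the edge sum, and truncated subtraction yields 0 for
  the empty list. Uniqueness of the data on the edges resolves the choice inside
  \<open>s_anchor\<close>.\<close>

lemma s_anchor_eq:
  assumes "cell_of G D (d, q, m) \<noteq> {}" "\<forall>e\<in>edges G. length (q e) \<le> 1"
  shows "s_anchor G D (cell_of G D (d, q, m)) = (\<Sum>e\<in>edges G. sum_list (q e) - 1)"
proof -
  have case_eq: "(case l of [c] \<Rightarrow> c - 1 | _ \<Rightarrow> 0) = sum_list l - 1" if "length l \<le> 1" for l :: "nat list"
    using that by (cases l) (auto split: list.splits)
  have sums: "(\<Sum>e\<in>edges G. (case p e of [c] \<Rightarrow> c - 1 | _ \<Rightarrow> 0)) = (\<Sum>e\<in>edges G. sum_list (q e) - 1)"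
    if "\<forall>e\<in>edges G. q e = p e" for p
    using that assms(2) case_eq by (intro sum.cong) auto
  show ?thesis unfolding s_anchor_def
  proof (rule some_equality)
    show "\<exists>d' p m'. cell_of G D (d, q, m) = cell_of G D (d', p, m') \<and>
        (\<Sum>e\<in>edges G. sum_list (q e) - 1) = (\<Sum>e\<in>edges G. case p e of [c] \<Rightarrow> c - 1 | _ \<Rightarrow> 0)"
      using sums[of q] by (intro exI[of _ d] exI[of _ q] exI[of _ m]) simp
  next
    fix n assume "\<exists>d' p m'. cell_of G D (d, q, m) = cell_of G D (d', p, m') \<and>
        n = (\<Sum>e\<in>edges G. case p e of [c] \<Rightarrow> c - 1 | _ \<Rightarrow> 0)"
    then obtain d' p m' where eq: "cell_of G D (d, q, m) = cell_of G D (d', p, m')"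
      and n: "n = (\<Sum>e\<in>edges G. case p e of [c] \<Rightarrow> c - 1 | _ \<Rightarrow> 0)" by blast
    show "n = (\<Sum>e\<in>edges G. sum_list (q e) - 1)"
      unfolding n by (rule sums[OF cell_of_eq_imp(2)[OF eq assms(1)]])
  qed
qed

section \<open>The fibre over one anchor cell\<close>

context
  fixes G :: "('v,'e) mgraph" and D d q m
  assumes G: "metric_graph G"
    and nonempty: "cell_of G D (d, q, m) \<noteq> {}"
    and short: "\<forall>e\<in>edges G. length (q e) \<le> 1"
begin

abbreviation "refinements \<equiv> composition_families (edges G) (\<lambda>e. sum_list (q e))"

lemma q_pos: "e \<in> edges G \<Longrightarrow> \<forall>k\<in>set (q e). 0 < k"
proof -
  assume e: "e \<in> edges G"
  obtain L where "in_cell G D (d, q, m) L" using nonempty unfolding cell_of_def by blast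
  from in_cell_pos[OF this e] show ?thesis .
qed

lemma refinement_edge:
  assumes "p \<in> refinements" "e \<in> edges G"
  shows "\<forall>k\<in>set (p e). 0 < k" "sum_list (p e) = sum_list (q e)" "p e = [] \<longleftrightarrow> q e = []"
proof -
  have "p e \<in> compositions (sum_list (q e))"
    using assms unfolding composition_families_def by blast
  then show pos: "\<forall>k\<in>set (p e). 0 < k" and sum: "sum_list (p e) = sum_list (q e)"
    unfolding compositions_def by blast+
  show "p e = [] \<longleftrightarrow> q e = []"
    using sum_list_pos_iff[OF pos] sum_list_pos_iff[OF q_pos[OF assms(2)]] unfolding sum by argo
qed

lemma refinement_nonempty: "p \<in> refinements \<Longrightarrow> cell_of G D (d, p, m) \<noteq> {}"
  by (intro change_partition_nonempty[OF G nonempty] conjI refinement_edge)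

lemma anchor_of_refinement:
  assumes "p \<in> refinements"
  shows "anchor_of G D (cell_of G D (d, p, m)) = cell_of G D (d, q, m)"
  unfolding anchor_of_cell[OF refinement_nonempty[OF assms]]
proof (rule cell_of_cong[OF refl _ refl])
  fix e assume e: "e \<in> edges G"
  note r = refinement_edge[OF assms e]
  show "merge p e = q e"
  proof (cases "q e")
    case Nil
    then show ?thesis using r(3) by (simp add: merge_def)
  next
    case (Cons c l)
    then have "q e = [c]" using short e by auto
    then show ?thesis using r(2,3) by (simp add: merge_def)
  qed
qed

lemma inj_on_refinements: "inj_on (\<lambda>p. cell_of G D (d, p, m)) refinements"
proof (rule inj_onI)
  fix p p' assume p: "p \<in> refinements" "p' \<in> refinements"
    and eq: "cell_of G D (d, p, m) = cell_of G D (d, p', m)"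
  show "p = p'"
  proof
    fix e
    show "p e = p' e"
      using cell_of_eq_imp(2)[OF eq refinement_nonempty[OF p(1)]] p
      by (cases "e \<in> edges G") (auto simp: composition_families_def)
  qed
qed

lemma anchor_of_fibre:
  "{C \<in> cells G D. anchor_of G D C = cell_of G D (d, q, m)} = (\<lambda>p. cell_of G D (d, p, m)) ` refinements"
proof (intro equalityI subsetI)
  fix C assume C: "C \<in> {C \<in> cells G D. anchor_of G D C = cell_of G D (d, q, m)}"
  then obtain d' p' m' where C': "C = cell_of G D (d', p', m')" "cell_of G D (d', p', m') \<noteq> {}"
    by (blast elim: cells_cases)
  have eq: "cell_of G D (d, q, m) = cell_of G D (d', merge p', m')"
    using C anchor_of_cell[OF C'(2)] unfolding C'(1) by simp
  note data = cell_of_eq_imp[OF eq nonempty]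
  \<comment> \<open>The data of \<open>C\<close> may take any value off the edges; resetting these
    to \<open>[]\<close> yields the member of \<open>refinements\<close> that describes the same
    cell.\<close>
  define p where "p e = (if e \<in> edges G then p' e else [])" for e
  have "C = cell_of G D (d, p, m)"
    unfolding C'(1) using data by (intro cell_of_cong) (simp_all add: p_def)
  moreover have "p \<in> refinements"
  proof -
    obtain L where L: "in_cell G D (d', p', m') L" using C'(2) unfolding cell_of_def by blast
    have "p e \<in> compositions (sum_list (q e))" if "e \<in> edges G" for e
      using in_cell_pos[OF L that] data(2) that sum_list_merge[of p' e]
      unfolding compositions_def p_def by simp
    then show ?thesis unfolding composition_families_def p_def by simp
  qed
  ultimately show "C \<in> (\<lambda>p. cell_of G D (d, p, m)) ` refinements" by blast
next
  fix C assume "C \<in> (\<lambda>p. cell_of G D (d, p, m)) ` refinements"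
  then obtain p where "p \<in> refinements" "C = cell_of G D (d, p, m)" by blast
  then show "C \<in> {C \<in> cells G D. anchor_of G D C = cell_of G D (d, q, m)}"
    using anchor_of_refinement in_cells[OF refinement_nonempty] by blast
qed

text \<open>Refining changes neither the set of edges without chips nor, therefore, the components
  containing a vertex. Only inner pieces are added, and the anchor cell has none.\<close>

lemma cell_dim_refinement:
  assumes "p \<in> refinements"
  shows "cell_dim G (cell_of G D (d, p, m)) =
    cell_dim G (cell_of G D (d, q, m)) + (\<Sum>e\<in>edges G. length (p e) - 1)"
proof -
  have "{e \<in> edges G. p e = []} = {e \<in> edges G. q e = []}" using refinement_edge(3)[OF assms] by blast
  moreover have "(\<Sum>e\<in>edges G. length (q e) - 1) = 0" using short by (intro sum.neutral) auto
  \<comment> \<open>There is at least one vertex class, so the \<open>- 1\<close> in the dimension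
    is not truncated.\<close>
  moreover have "finite (verts G)" "verts G \<noteq> {}" using G unfolding metric_graph_def by blast+
  then have "0 < card (vertex_class G {e \<in> edges G. q e = []} ` verts G)" by (simp add: card_gt_0_iff)
  ultimately show ?thesis
    unfolding cell_dim_eq[OF G nonempty] cell_dim_eq[OF G refinement_nonempty[OF assms]] by simp
qed

lemma card_anchor_of_fibre:
  "card {C \<in> cells G D. anchor_of G D C = cell_of G D (d, q, m)} = 2 ^ s_anchor G D (cell_of G D (d, q, m))"
proof -
  have "finite (edges G)" using G unfolding metric_graph_def by blast
  then show ?thesis
    unfolding anchor_of_fibre card_image[OF inj_on_refinements] s_anchor_eq[OF nonempty short]
    by (rule card_all_composition_families)
qed

lemma card_anchor_of_fibre_dim:
  "card {C \<in> cells G D. anchor_of G D C = cell_of G D (d, q, m) \<and>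
      cell_dim G C = cell_dim G (cell_of G D (d, q, m)) + j}
    = s_anchor G D (cell_of G D (d, q, m)) choose j"
proof -
  let ?R = "{p \<in> refinements. (\<Sum>e\<in>edges G. length (p e) - 1) = j}"
  have fin: "finite (edges G)" using G unfolding metric_graph_def by blast
  have "{C \<in> cells G D. anchor_of G D C = cell_of G D (d, q, m) \<and>
      cell_dim G C = cell_dim G (cell_of G D (d, q, m)) + j}
    = {C \<in> (\<lambda>p. cell_of G D (d, p, m)) ` refinements.
        cell_dim G C = cell_dim G (cell_of G D (d, q, m)) + j}"
    unfolding anchor_of_fibre[symmetric] by blast
  also have "\<dots> = (\<lambda>p. cell_of G D (d, p, m)) ` ?R"
    using cell_dim_refinement by auto
  finally have "card {C \<in> cells G D. anchor_of G D C = cell_of G D (d, q, m) \<and>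
      cell_dim G C = cell_dim G (cell_of G D (d, q, m)) + j} = card ?R"
    using card_image[OF inj_on_subset[OF inj_on_refinements, of ?R]] by simp
  then show ?thesis
    unfolding card_composition_families[OF fin] s_anchor_eq[OF nonempty short] .
qed

end

theorem theorem2p12:
  fixes G :: "('v,'e) mgraph" and D :: "('v,'e) gpoint \<Rightarrow> int"
  assumes "metric_graph G"
    and "effective D" and "vertex_supported G D"
  shows "\<exists>a. (\<forall>C\<in>cells G D. a C \<in> anchor_cells G D \<and>
              (\<forall>L\<in>C. \<exists>N\<in>a C. anchor_div G N \<and>
                  (\<forall>v\<in>verts G. N (Vert v) = L (Vert v)) \<and>
                  (\<forall>f\<in>RD G D. \<forall>g\<in>RD G D.
                     L = (\<lambda>x. D x + prin_div G f x) \<and> N = (\<lambda>x. D x + prin_div G g x) \<longrightarrow>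
                     (\<forall>e\<in>edges G.
                        dslope (edge_fun G f e) 0 1 = dslope (edge_fun G g e) 0 1 \<and>
                        dslope (edge_fun G f e) (elen G e) (-1) = dslope (edge_fun G g e) (elen G e) (-1)))))
          \<and> (\<forall>A\<in>anchor_cells G D.
               card {C \<in> cells G D. a C = A} = 2 ^ s_anchor G D A \<and>
               (\<forall>j\<le>s_anchor G D A.
                  card {C \<in> cells G D. a C = A \<and> cell_dim G C = cell_dim G A + j}
                    = s_anchor G D A choose j))"
proof (intro exI[of _ "anchor_of G D"] conjI ballI)
  fix C assume "C \<in> cells G D"
  then obtain d p m where C: "C = cell_of G D (d, p, m)" "cell_of G D (d, p, m) \<noteq> {}"
    by (rule cells_cases)
  note ne = merge_nonempty[OF assms(1) C(2)]
  have short: "\<forall>e\<in>edges G. length (merge p e) \<le> 1" by (simp add: merge_def)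
  have aC: "anchor_of G D C = cell_of G D (d, merge p, m)" unfolding C(1) by (rule anchor_of_cell[OF C(2)])
  show "anchor_of G D C \<in> anchor_cells G D"
    unfolding aC anchor_cells_iff[OF ne] by (rule short)
  fix L assume "L \<in> C"
  then have L: "in_cell G D (d, p, m) L" unfolding C(1) cell_of_def by simp
  \<comment> \<open>\<open>N\<close> need not be a rearrangement of \<open>L\<close>: conditions (i)
    and (ii) depend only on \<open>d\<close>, \<open>m\<close> and the edge sums, which the two
    cells share, so any representative serves.\<close>
  obtain N where N: "in_cell G D (d, merge p, m) N" using ne unfolding cell_of_def by blast
  show "\<exists>N\<in>anchor_of G D C. anchor_div G N \<and>
                  (\<forall>v\<in>verts G. N (Vert v) = L (Vert v)) \<and>
                  (\<forall>f\<in>RD G D. \<forall>g\<in>RD G D.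
                     L = (\<lambda>x. D x + prin_div G f x) \<and> N = (\<lambda>x. D x + prin_div G g x) \<longrightarrow>
                     (\<forall>e\<in>edges G.
                        dslope (edge_fun G f e) 0 1 = dslope (edge_fun G g e) 0 1 \<and>
                        dslope (edge_fun G f e) (elen G e) (-1) = dslope (edge_fun G g e) (elen G e) (-1)))"
  proof (intro bexI[of _ N] conjI ballI impI)
    show "N \<in> anchor_of G D C" unfolding aC cell_of_def using N by simp
    show "anchor_div G N" unfolding anchor_div_iff[OF N] by (rule short)
    show "N (Vert v) = L (Vert v)" if "v \<in> verts G" for v
      using N L that unfolding in_cell_iff by metis
    fix f g e
    assume f: "f \<in> RD G D" and g: "g \<in> RD G D"
      and LN: "L = (\<lambda>x. D x + prin_div G f x) \<and> N = (\<lambda>x. D x + prin_div G g x)"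
      and e: "e \<in> edges G"
    have "dslope (edge_fun G f e) 0 1 = m e" using L f LN e unfolding in_cell_iff by blast
    moreover have "dslope (edge_fun G g e) 0 1 = m e" using N g LN e unfolding in_cell_iff by blast
    ultimately show "dslope (edge_fun G f e) 0 1 = dslope (edge_fun G g e) 0 1" by simp
    show "dslope (edge_fun G f e) (elen G e) (-1) = dslope (edge_fun G g e) (elen G e) (-1)"
      \<comment> \<open>Both target slopes equal - m e minus the number of chips on
        \<open>e\<close>, and merging keeps that number.\<close>
      unfolding in_cell_end_slope[OF assms(3) L f conjunct1[OF LN] e]
        in_cell_end_slope[OF assms(3) N g conjunct2[OF LN] e] sum_list_merge ..
  qed
next
  fix A assume A: "A \<in> anchor_cells G D"
  then have "A \<in> cells G D" unfolding anchor_cells_def by blast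
  then obtain d q m where A': "A = cell_of G D (d, q, m)" "cell_of G D (d, q, m) \<noteq> {}"
    by (rule cells_cases)
  have short: "\<forall>e\<in>edges G. length (q e) \<le> 1"
    using A unfolding A'(1) anchor_cells_iff[OF A'(2)] .
  show "card {C \<in> cells G D. anchor_of G D C = A} = 2 ^ s_anchor G D A"
    unfolding A'(1) by (rule card_anchor_of_fibre[OF assms(1) A'(2) short])
  show "\<forall>j\<le>s_anchor G D A. card {C \<in> cells G D. anchor_of G D C = A \<and> cell_dim G C = cell_dim G A + j}
      = s_anchor G D A choose j"
    unfolding A'(1) by (intro allI impI card_anchor_of_fibre_dim[OF assms(1) A'(2) short])
qed

end
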